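(* Let $a,b>0$, let $\mathcal{E}$ be the ellipse $\frac{x^2}{a}+\frac{y^2}{b}=1$ in the Minkowski plane, let $\gamma\in\mathbb{R}\setminus\{-b,0,a\}$, and let $n\ge3$ be an integer. The billiard trajectories within $\mathcal{E}$ with caustic $\mathcal{C}_\gamma$ are $n$-periodic if and only if there exists a pair of real polynomials $p_{d_1}$, $q_{d_2}$ of degrees $d_1$, $d_2$ respectively, satisfying the following: (a) if $n=2m$ is even, then $d_1=m$, $d_2=m-2$, and $$p_m^2(s)-s\left(s-\frac1a\right)\left(s+\frac1b\right)\left(s-\frac1\gamma\right)q_{m-2}^2(s)=1;$$ (b) if $n=2m+1$ is odd, then $d_1=m$, $d_2=m-1$, and $$\left(s-\frac1\gamma\right)p_m^2(s)-s\left(s-\frac1a\right)\left(s+\frac1b\right)q_{m-1}^2(s)=-\operatorname{sign}\gamma.$$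
   Context: The Minkowski plane is $\mathbb{R}^2$ with the scalar product $\langle X,Y\rangle=X_1Y_1-X_2Y_2$; vectors $X,Y$ are orthogonal if $\langle X,Y\rangle=0$, and $v$ is light-like if $\langle v,v\rangle=0$. The family of conics confocal with $\mathcal{E}$ is $\mathcal{C}_\lambda:\ \frac{x^2}{a-\lambda}+\frac{y^2}{b+\lambda}=1$, $\lambda\in\mathbb{R}$; $\mathcal{C}_\lambda$ is an ellipse for $\lambda\in(-b,a)$ and a hyperbola for $\lambda<-b$ or $\lambda>a$. Billiard reflection: given a line $p$ that is not light-like and a vector $v$, write $v=u+w$ with $u$ parallel to $p$ and $w$ orthogonal to $p$ (in the Minkowski sense); the reflection of $v$ on $p$ is $u-w$. A billiard trajectory within $\mathcal{E}$ is a polygonal line with vertices on $\mathcal{E}$ such that the directions of consecutive segments are billiard reflections of each other with respect to the tangent line of $\mathcal{E}$ at the common vertex (the reflection is not defined where this tangent line is light-like). All lines containing segments of a given trajectory are tangent to the same conic $\mathcal{C}_\gamma$ of the confocal family, called the caustic of the trajectory; the caustic is non-degenerate when $\gamma\in\mathbb{R}\setminus\{-b,a\}$. A trajectory is $n$-periodic if it closes after $n$ reflections ($n$ is not required to be the minimal such number). *)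

theory Defs
  imports "HOL-Analysis.Analysis" "HOL-Computational_Algebra.Polynomial"
begin

type_synonym plane = "real \<times> real"

definition mink :: "plane \<Rightarrow> plane \<Rightarrow> real" where
  "mink X Y = fst X * fst Y - snd X * snd Y"

definition mink_orthogonal :: "plane \<Rightarrow> plane \<Rightarrow> bool" where
  "mink_orthogonal X Y \<longleftrightarrow> mink X Y = 0"

definition light_like :: "plane \<Rightarrow> bool" where
  "light_like v \<longleftrightarrow> mink v v = 0"

definition conic :: "real \<Rightarrow> real \<Rightarrow> plane set" where
  "conic A B = {X. (fst X)\<^sup>2 / A + (snd X)\<^sup>2 / B = 1}"

(* The bilinear form polar to x^2/A + y^2/B; at a point X of the conic its
   zeros v are the tangent directions. *)
definition conic_form :: "real \<Rightarrow> real \<Rightarrow> plane \<Rightarrow> plane \<Rightarrow> real" where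
  "conic_form A B X v = fst X * fst v / A + snd X * snd v / B"

definition tangent_direction :: "real \<Rightarrow> real \<Rightarrow> plane \<Rightarrow> plane \<Rightarrow> bool" where
  "tangent_direction A B X d \<longleftrightarrow> d \<noteq> 0 \<and> conic_form A B X d = 0"

(* Tangency of the line through P with direction v \<noteq> 0 to the conic
   x^2/A + y^2/B = 1.  Tangency is understood in the projective plane: the second
   disjunct is contact at the point at infinity of the line, that is, the line is
   an asymptote of a hyperbola.  A trajectory may contain a segment lying on an
   asymptote of its caustic, so this case has to be allowed. *)
definition line_tangent :: "real \<Rightarrow> real \<Rightarrow> plane \<Rightarrow> plane \<Rightarrow> bool" where
  "line_tangent A B P v \<longleftrightarrow>
     (\<exists>t. P + t *\<^sub>R v \<in> conic A B \<and> tangent_direction A B (P + t *\<^sub>R v) v) \<or>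
     (v \<noteq> 0 \<and> conic_form A B v v = 0 \<and> conic_form A B P v = 0)"

(* v' is the reflection of v on a line with direction d; for d not light-like the
   decomposition v = u + w exists and is unique. *)
definition mink_reflection :: "plane \<Rightarrow> plane \<Rightarrow> plane \<Rightarrow> bool" where
  "mink_reflection d v v' \<longleftrightarrow>
     (\<exists>u w. v = u + w \<and> (\<exists>c. u = c *\<^sub>R d) \<and> mink_orthogonal w d \<and> v' = u - w)"

(* X lists the consecutive vertices.  A polygonal line reaching one of the four
   points of the ellipse with light-like tangent cannot be continued, since the
   reflection is undefined there; such terminating lines are not trajectories.
   The factor k accounts for the reflection law concerning directions only. *)
definition billiard_trajectory :: "real \<Rightarrow> real \<Rightarrow> (nat \<Rightarrow> plane) \<Rightarrow> bool" where
  "billiard_trajectory a b X \<longleftrightarrow>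
     (\<forall>i. X i \<in> conic a b \<and> X (i + 1) \<noteq> X i) \<and>
     (\<forall>i. \<exists>d k. tangent_direction a b (X (i + 1)) d \<and> \<not> light_like d \<and> k > 0 \<and>
            mink_reflection d (X (i + 1) - X i) (k *\<^sub>R (X (i + 2) - X (i + 1))))"

(* Tangency to the confocal conic x^2/(a - \<gamma>) + y^2/(b + \<gamma>) = 1. *)
definition has_caustic :: "real \<Rightarrow> real \<Rightarrow> real \<Rightarrow> (nat \<Rightarrow> plane) \<Rightarrow> bool" where
  "has_caustic a b \<gamma> X \<longleftrightarrow> (\<forall>i. line_tangent (a - \<gamma>) (b + \<gamma>) (X i) (X (i + 1) - X i))"

definition n_periodic :: "nat \<Rightarrow> (nat \<Rightarrow> plane) \<Rightarrow> bool" where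
  "n_periodic n X \<longleftrightarrow> (\<forall>i. X (i + n) = X i)"

end

theory Submission
  imports Defs "HOL-Computational_Algebra.Polynomial_Factorial"
    "HOL-Computational_Algebra.Field_as_Ring" "HOL-Library.Landau_Symbols"
begin

text \<open>
  Put \<open>A = 1/a\<close>, \<open>B = 1/b\<close>, \<open>g = 1/\<gamma>\<close>. With velocities suitably normalized, one bounce acts on the
  two coordinate pairs (position, velocity) by one and the same unimodular matrix
  \<open>T s = ((1, \<mu>), (s \<nu>, 1 + s \<mu> \<nu>))\<close>, evaluated at \<open>s = A\<close> and \<open>s = -B\<close>. There is a Lax matrix \<open>L s\<close>
  with \<open>T L = L' T\<close>, \<open>L\<^sup>2 = R\<close> for \<open>R s = s (s - A) (s + B) (s - g)\<close>, whose kernels at \<open>A\<close> and \<open>-B\<close> contain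
  the coordinate pairs. Let \<open>M\<close> be the product of \<open>n\<close> consecutive \<open>T\<close>.

  If the orbit is \<open>n\<close>-periodic, \<open>M\<close> commutes with \<open>L\<close>, so \<open>M = P + Q L\<close> with \<open>P\<^sup>2 - R Q\<^sup>2 = 1\<close>, \<open>P\<close> of
  degree \<open>n\<close> and \<open>P = 1\<close> at \<open>0\<close>, \<open>A\<close>, \<open>-B\<close>. Conversely, given such \<open>P\<close> and \<open>Q\<close>, the matrices
  \<open>N = P + Q L\<close> and \<open>M\<close> have the same behaviour at infinity on the eigenvectors of \<open>L\<close>; hence
  \<open>N M\<^sup>-\<^sup>1\<close> is a bounded polynomial, that is, constant, and the values at \<open>0\<close>, \<open>A\<close>, \<open>-B\<close> force the orbit to
  close. Splitting \<open>(P - 1) (P + 1) = R Q\<^sup>2\<close> into coprime factors turns these Pell equations into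
  those of the theorem. Finally, only countably many initial states lead to a point with
  light-like tangent, so trajectories exist for every caustic.
\<close>

section \<open>Splitting the Pell equation\<close>

text \<open>The square root is \<open>gcd u q\<close>: its square is the gcd of \<open>u * u\<close>
  and \<open>q * q = u * v\<close>, which coprimality of \<open>u\<close> and \<open>v\<close>
  collapses to \<open>u\<close> up to a unit.\<close>

lemma coprime_mult_square_factor:
  fixes u v q :: "real poly"
  assumes "coprime u v" and uv: "u * v = q\<^sup>2"
  shows "\<exists>p. u = smult (lead_coeff u) (p\<^sup>2)"
proof -
  have "(gcd u q)\<^sup>2 = gcd (u * u) (u * v)"
    using uv gcd_exp [of u 2 q] by (simp only: power2_eq_square)
  also have "\<dots> = normalize u"
    using assms(1) by (simp add: gcd_mult_left)
  finally have "u = unit_factor u * (gcd u q)\<^sup>2"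
    by simp
  then show ?thesis
    by (auto simp: unit_factor_poly_def)
qed

lemma poly_eq_by_eval:
  fixes p q :: "real poly"
  shows "(\<And>s. poly p s = poly q s) \<Longrightarrow> p = q"
  by (metis poly_eq_poly_eq_iff ext)

lemma degree_diff_one:
  fixes p :: "'a::comm_ring_1 poly"
  shows "0 < degree p \<Longrightarrow> degree (p - 1) = degree p"
  using degree_add_eq_left [of "- 1" p] by simp

lemma three_roots_dvd:
  fixes p :: "'a::field poly"
  assumes "poly p x = 0" "poly p y = 0" "poly p z = 0" "x \<noteq> y" "x \<noteq> z" "y \<noteq> z"
  shows "[:-x, 1:] * [:-y, 1:] * [:-z, 1:] dvd p"
proof -
  obtain q where q: "p = [:-x, 1:] * q"
    using assms(1) by (auto simp: poly_eq_0_iff_dvd elim: dvdE)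
  with assms have "poly q y = 0" by auto
  then obtain r where r: "q = [:-y, 1:] * r"
    by (auto simp: poly_eq_0_iff_dvd elim: dvdE)
  with q assms have "poly r z = 0" by auto
  then obtain t where "r = [:-z, 1:] * t"
    by (auto simp: poly_eq_0_iff_dvd elim: dvdE)
  then show ?thesis
    by (metis q r dvd_triv_left mult.assoc)
qed

definition cubic :: "real \<Rightarrow> real \<Rightarrow> real poly" where
  "cubic A B = [:0, 1:] * [:-A, 1:] * [:B, 1:]"

text \<open>The Pell equation forces \<open>P\<close> to be 1 or -1 at each of \<open>0\<close>,
  \<open>A\<close>, \<open>-B\<close>, \<open>g\<close>. The sign at \<open>g\<close> is left free;
  in \<open>pell_split\<close> it decides the parity of \<open>n\<close>.\<close>

definition pell_solvable :: "real \<Rightarrow> real \<Rightarrow> real \<Rightarrow> nat \<Rightarrow> bool" where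
  "pell_solvable A B g n \<longleftrightarrow> (\<exists>P Q. degree P = n \<and> P\<^sup>2 - cubic A B * [:-g, 1:] * Q\<^sup>2 = 1 \<and>
     poly P 0 = 1 \<and> poly P A = 1 \<and> poly P (-B) = 1)"

lemma poly_cubic: "poly (cubic A B) s = s * (s - A) * (s + B)"
  by (simp add: cubic_def algebra_simps)

lemma degree_cubic: "degree (cubic A B) = 3" and lead_coeff_cubic: "lead_coeff (cubic A B) = 1"
  and cubic_nonzero: "cubic A B \<noteq> 0"
proof -
  show "degree (cubic A B) = 3" "cubic A B \<noteq> 0"
    unfolding cubic_def by (simp_all add: degree_mult_eq)
  show "lead_coeff (cubic A B) = 1"
    unfolding cubic_def lead_coeff_mult by simp
qed

text \<open>With \<open>U = P + 1\<close> and \<open>P - 1 = cubic A B * V\<close>, the equation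
  becomes \<open>U * V = [:-g, 1:] * Q^2\<close>, and \<open>U - cubic A B * V = 2\<close> makes
  \<open>U\<close> and \<open>V\<close> coprime. Hence each is a constant times a square once the
  factor \<open>[:-g, 1:]\<close> is removed from the one it divides: from \<open>V\<close> for even
  \<open>n\<close>, from \<open>U\<close> for odd \<open>n\<close>.\<close>

lemma pell_split:
  assumes AB: "A > 0" "B > 0" and g: "g \<noteq> 0" "g \<noteq> A" "g \<noteq> -B" and n: "n > 0"
    and "pell_solvable A B g n"
  shows "\<exists>p q c d. c \<noteq> 0 \<and> d \<noteq> 0 \<and> p \<noteq> 0 \<and> q \<noteq> 0 \<and> c * d > 0 \<and>
     (n = 2 * degree p \<and> n = 2 * degree q + 4 \<and>
        smult c (p\<^sup>2) - smult d (cubic A B * [:-g, 1:] * q\<^sup>2) = [:2:]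
    \<or> n = 2 * degree p + 1 \<and> n = 2 * degree q + 3 \<and>
        smult c ([:-g, 1:] * p\<^sup>2) - smult d (cubic A B * q\<^sup>2) = [:2:])"
proof -
  obtain P Q where P: "degree P = n" and PQ: "P\<^sup>2 - cubic A B * [:-g, 1:] * Q\<^sup>2 = 1"
    and P1: "poly P 0 = 1" "poly P A = 1" "poly P (-B) = 1"
    using assms(7) unfolding pell_solvable_def by auto
  have "cubic A B dvd P - 1"
    using three_roots_dvd [of "P - 1" 0 A "-B"] P1 AB by (simp add: cubic_def)
  then obtain V where V: "P - 1 = cubic A B * V" ..
  define U where "U = P + 1"
  have UV2: "U - cubic A B * V = [:2:]"
    using V unfolding U_def by (simp add: algebra_simps numeral_poly)
  have degs: "degree (P + 1) = n" "degree (P - 1) = n"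
    using P n by (auto simp: degree_add_eq_left degree_diff_one)
  have degU: "degree U = n" using degs unfolding U_def by simp
  have U0: "U \<noteq> 0" using degU n by auto
  have V0: "V \<noteq> 0" using V degs n by auto
  have degV: "3 + degree V = n"
    using degs(2) V V0 by (simp add: degree_mult_eq cubic_nonzero degree_cubic)
  have "cubic A B * (U * V) = (P + 1) * (P - 1)"
    using V by (simp add: U_def mult_ac)
  also have "\<dots> = cubic A B * ([:-g, 1:] * Q\<^sup>2)"
    using PQ by (simp add: algebra_simps power2_eq_square)
  finally have UV: "U * V = [:-g, 1:] * Q\<^sup>2"
    using cubic_nonzero by simp
  have Q0: "Q \<noteq> 0" using UV U0 V0 by auto
  have cop: "coprime U V"
  proof (rule coprimeI)
    fix d assume "d dvd U" "d dvd V"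
    then have "d dvd [:2:]" using UV2 by (metis dvd_diff dvd_mult)
    then show "is_unit d" by (simp add: is_unit_triv dvd_trans)
  qed
  \<comment> \<open>This is the source of \<open>c * d > 0\<close>: \<open>c\<close> and
    \<open>d\<close> will be these leading coefficients.\<close>
  have lead: "lead_coeff V = lead_coeff U"
  proof -
    have "lead_coeff U = lead_coeff (P - 1)"
    proof -
      have "coeff (P + 1) n = coeff P n" "coeff (P - 1) n = coeff P n"
        using n by (auto simp: coeff_eq_0)
      then show ?thesis using degs unfolding U_def by simp
    qed
    also have "\<dots> = lead_coeff V" unfolding V lead_coeff_mult lead_coeff_cubic by simp
    finally show ?thesis by simp
  qed
  have "poly U g = 0 \<or> poly V g = 0"
    using arg_cong [OF UV, of "\<lambda>p. poly p g"] by simp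
  then show ?thesis
  proof
    assume "poly V g = 0"
    then obtain W where W: "V = [:-g, 1:] * W"
      by (auto simp: poly_eq_0_iff_dvd elim: dvdE)
    have UW: "U * W = Q\<^sup>2"
    proof -
      have "[:-g, 1:] * (U * W) = [:-g, 1:] * Q\<^sup>2" using UV W by (simp only: mult_ac)
      then show ?thesis by (simp only: mult_cancel_left) simp
    qed
    have copUW: "coprime U W" using cop W by (metis coprime_mult_right_iff)
    obtain p where p: "U = smult (lead_coeff U) (p\<^sup>2)"
      using coprime_mult_square_factor [OF copUW UW] by auto
    obtain q where q: "W = smult (lead_coeff W) (q\<^sup>2)"
      using coprime_mult_square_factor [of W U Q] copUW UW by (auto simp: ac_simps)
    have W0: "W \<noteq> 0" using V0 W by auto
    have p0: "p \<noteq> 0" and q0: "q \<noteq> 0" using p q U0 W0 by auto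
    have dp: "degree U = 2 * degree p"
      using U0 p0 by (subst p) (simp add: degree_power_eq)
    have dq: "degree W = 2 * degree q"
      using W0 q0 by (subst q) (simp add: degree_power_eq)
    have dV: "degree V = 1 + degree W"
      unfolding W using W0 by (subst degree_mult_eq) auto
    have lW: "lead_coeff V = lead_coeff W" unfolding W lead_coeff_mult by simp
    have "smult (lead_coeff U) (p\<^sup>2) - smult (lead_coeff W) (cubic A B * [:-g, 1:] * q\<^sup>2)
        = U - cubic A B * [:-g, 1:] * W"
      using p q by (metis mult_smult_right)
    also have "\<dots> = [:2:]" using UV2 W by (simp only: mult.assoc)
    finally have "smult (lead_coeff U) (p\<^sup>2) - smult (lead_coeff W) (cubic A B * [:-g, 1:] * q\<^sup>2) = [:2:]" .
    moreover have nz: "lead_coeff U \<noteq> 0" "lead_coeff W \<noteq> 0"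
      using U0 W0 by auto
    moreover have "lead_coeff U * lead_coeff W > 0"
      using lead lW nz by (metis not_real_square_gt_zero)
    moreover have "n = 2 * degree p" "n = 2 * degree q + 4"
      using degU degV dV dp dq by auto
    ultimately show ?thesis using p0 q0 by blast
  next
    assume "poly U g = 0"
    then obtain W where W: "U = [:-g, 1:] * W"
      by (auto simp: poly_eq_0_iff_dvd elim: dvdE)
    have WV: "W * V = Q\<^sup>2"
    proof -
      have "[:-g, 1:] * (W * V) = [:-g, 1:] * Q\<^sup>2" using UV W by (simp only: mult_ac)
      then show ?thesis by (simp only: mult_cancel_left) simp
    qed
    have copWV: "coprime W V" using cop W by (metis coprime_mult_left_iff)
    obtain p where p: "W = smult (lead_coeff W) (p\<^sup>2)"
      using coprime_mult_square_factor [OF copWV WV] by auto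
    obtain q where q: "V = smult (lead_coeff V) (q\<^sup>2)"
      using coprime_mult_square_factor [of V W Q] copWV WV by (auto simp: ac_simps)
    have W0: "W \<noteq> 0" using U0 W by auto
    have p0: "p \<noteq> 0" and q0: "q \<noteq> 0" using p q V0 W0 by auto
    have dp: "degree W = 2 * degree p"
      using W0 p0 by (subst p) (simp add: degree_power_eq)
    have dq: "degree V = 2 * degree q"
      using V0 q0 by (subst q) (simp add: degree_power_eq)
    have dU: "degree U = 1 + degree W"
      unfolding W using W0 by (subst degree_mult_eq) auto
    have lW: "lead_coeff U = lead_coeff W" unfolding W lead_coeff_mult by simp
    have "smult (lead_coeff W) ([:-g, 1:] * p\<^sup>2) - smult (lead_coeff V) (cubic A B * q\<^sup>2)
        = [:-g, 1:] * W - cubic A B * V"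
      using p q by (metis mult_smult_right)
    also have "\<dots> = [:2:]" using UV2 W by simp
    finally have "smult (lead_coeff W) ([:-g, 1:] * p\<^sup>2) - smult (lead_coeff V) (cubic A B * q\<^sup>2) = [:2:]" .
    moreover have nz: "lead_coeff V \<noteq> 0" "lead_coeff W \<noteq> 0"
      using V0 W0 by auto
    moreover have "lead_coeff W * lead_coeff V > 0"
      using lead lW nz by (metis not_real_square_gt_zero)
    moreover have "n = 2 * degree p + 1" "n = 2 * degree q + 3"
      using degU degV dU dp dq by auto
    ultimately show ?thesis using p0 q0 by blast
  qed
qed

text \<open>One direction rescales the two squares from \<open>pell_split\<close>, the other is a
  double-angle formula. For given \<open>n\<close> only one of the two parity clauses is not
  vacuous.\<close>

lemma pell_solvable_iff:
  fixes a b \<gamma> :: real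
  assumes ab: "a > 0" "b > 0" and g: "\<gamma> \<notin> {-b, 0, a}" and n: "n \<ge> 3"
  shows "pell_solvable (1 / a) (1 / b) (1 / \<gamma>) n \<longleftrightarrow>
    (\<exists>p q :: real poly.
       (\<forall>m. n = 2 * m \<longrightarrow>
          degree p = m \<and> degree q = m - 2 \<and>
          (\<forall>s. (poly p s)\<^sup>2 - s * (s - 1 / a) * (s + 1 / b) * (s - 1 / \<gamma>) * (poly q s)\<^sup>2 = 1)) \<and>
       (\<forall>m. n = 2 * m + 1 \<longrightarrow>
          degree p = m \<and> degree q = m - 1 \<and>
          (\<forall>s. (s - 1 / \<gamma>) * (poly p s)\<^sup>2 - s * (s - 1 / a) * (s + 1 / b) * (poly q s)\<^sup>2
                 = - sgn \<gamma>)))"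
    (is "_ \<longleftrightarrow> (\<exists>p q. ?R p q)")
proof
  define C where "C = cubic (1 / a) (1 / b)"
  assume "pell_solvable (1 / a) (1 / b) (1 / \<gamma>) n"
  moreover have "1 / \<gamma> \<noteq> 1 / a" "1 / \<gamma> \<noteq> - (1 / b)"
    using g ab by (auto simp: field_simps)
  ultimately obtain p q c d where nz: "c \<noteq> 0" "d \<noteq> 0" "p \<noteq> 0" "q \<noteq> 0" and cd: "c * d > 0"
    and pq: "n = 2 * degree p \<and> n = 2 * degree q + 4 \<and>
        smult c (p\<^sup>2) - smult d (C * [:-(1 / \<gamma>), 1:] * q\<^sup>2) = [:2:]
    \<or> n = 2 * degree p + 1 \<and> n = 2 * degree q + 3 \<and>
        smult c ([:-(1 / \<gamma>), 1:] * p\<^sup>2) - smult d (C * q\<^sup>2) = [:2:]"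
    using pell_split [of "1 / a" "1 / b" "1 / \<gamma>" n] ab g n unfolding C_def by auto
  have halve: "2 * (X * (e / 2 * v) - Y * (f / 2 * t)) = e * (X * v) - f * (Y * t)" for X Y e f v t :: real
    by (simp add: field_simps)
  have lin: "poly [:-(1 / \<gamma>), 1:] s = s - 1 / \<gamma>" for s
    by simp
  have const: "poly [:2:] s = 2" for s :: real
    by simp
  define p' where "p' = smult (sqrt (\<bar>c\<bar> / 2)) p"
  define q' where "q' = smult (sqrt (\<bar>d\<bar> / 2)) q"
  have deg: "degree p' = degree p" "degree q' = degree q"
    using nz unfolding p'_def q'_def by auto
  have sq: "(poly p' s)\<^sup>2 = \<bar>c\<bar> / 2 * (poly p s)\<^sup>2" "(poly q' s)\<^sup>2 = \<bar>d\<bar> / 2 * (poly q s)\<^sup>2" for s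
    unfolding p'_def q'_def by (simp_all add: power_mult_distrib)
  have "?R p' q'"
    using pq
  proof (elim disjE conjE)
    assume n2: "n = 2 * degree p" "n = 2 * degree q + 4"
      and eq: "smult c (p\<^sup>2) - smult d (C * [:-(1 / \<gamma>), 1:] * q\<^sup>2) = [:2:]"
    have ev: "c * (poly p s)\<^sup>2 - d * (s * (s - 1 / a) * (s + 1 / b) * (s - 1 / \<gamma>)) * (poly q s)\<^sup>2 = 2" for s
      using arg_cong [OF eq, of "\<lambda>p. poly p s"] lin [of s]
      by (simp only: poly_diff poly_smult poly_mult poly_power poly_cubic C_def mult.assoc const)
    \<comment> \<open>The quartic vanishes at 0, which reveals the sign of \<open>c\<close>.\<close>
    have "c * (poly p 0)\<^sup>2 = 2" using ev [of 0] by simp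
    then have "c > 0" by (metis mult_nonpos_nonneg not_le zero_le_power2 zero_less_numeral)
    then have "d > 0" using cd by (simp add: zero_less_mult_iff)
    have "(poly p' s)\<^sup>2 - s * (s - 1 / a) * (s + 1 / b) * (s - 1 / \<gamma>) * (poly q' s)\<^sup>2 = 1" for s
      using ev [of s] \<open>c > 0\<close> \<open>d > 0\<close> unfolding sq
      by (simp add: mult_ac diff_divide_distrib [symmetric])
    moreover have "n = 2 * m \<Longrightarrow> degree p' = m \<and> degree q' = m - 2" for m using n2 deg by auto
    moreover have "n = 2 * m + 1 \<Longrightarrow> False" for m using n2(1) by presburger
    ultimately show ?thesis by blast
  next
    assume n2: "n = 2 * degree p + 1" "n = 2 * degree q + 3"
      and eq: "smult c ([:-(1 / \<gamma>), 1:] * p\<^sup>2) - smult d (C * q\<^sup>2) = [:2:]"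
    have ev: "c * ((s - 1 / \<gamma>) * (poly p s)\<^sup>2) - d * (s * (s - 1 / a) * (s + 1 / b) * (poly q s)\<^sup>2) = 2" for s
      using arg_cong [OF eq, of "\<lambda>p. poly p s"] lin [of s]
      by (simp only: poly_diff poly_smult poly_mult poly_power poly_cubic C_def mult.assoc const)
    \<comment> \<open>At 0 the linear factor equals \<open>-1 / \<gamma>\<close>, so here
      \<open>c\<close> has the sign opposite to that of \<open>\<gamma>\<close>; this is the
      right-hand side of the odd equation.\<close>
    have "c * (- 1 / \<gamma>) * (poly p 0)\<^sup>2 = 2" using ev [of 0] by simp
    then have "c * (- 1 / \<gamma>) > 0" by (metis mult_nonpos_nonneg not_le zero_le_power2 zero_less_numeral)
    then have sc: "sgn c = - sgn \<gamma>"
      by (auto simp: zero_less_mult_iff sgn_if divide_less_0_iff zero_less_divide_iff split: if_splits)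
    have sd: "sgn d = sgn c" using cd by (auto simp: sgn_if zero_less_mult_iff)
    have "(s - 1 / \<gamma>) * (poly p' s)\<^sup>2 - s * (s - 1 / a) * (s + 1 / b) * (poly q' s)\<^sup>2 = - sgn \<gamma>" for s
    proof -
      have "2 * ((s - 1 / \<gamma>) * (poly p' s)\<^sup>2 - s * (s - 1 / a) * (s + 1 / b) * (poly q' s)\<^sup>2)
        = \<bar>c\<bar> * ((s - 1 / \<gamma>) * (poly p s)\<^sup>2) - \<bar>d\<bar> * (s * (s - 1 / a) * (s + 1 / b) * (poly q s)\<^sup>2)"
        unfolding sq by (rule halve)
      also have "\<dots> = sgn c * (c * ((s - 1 / \<gamma>) * (poly p s)\<^sup>2) - d * (s * (s - 1 / a) * (s + 1 / b) * (poly q s)\<^sup>2))"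
        using sd unfolding abs_sgn by (simp add: right_diff_distrib mult_ac)
      also have "\<dots> = sgn c * 2" unfolding ev ..
      finally show ?thesis using sc by simp
    qed
    moreover have "n = 2 * m + 1 \<Longrightarrow> degree p' = m \<and> degree q' = m - 1" for m using n2 deg by auto
    moreover have "n = 2 * m \<Longrightarrow> False" for m using n2(1) by presburger
    ultimately show ?thesis by blast
  qed
  then show "\<exists>p q. ?R p q" by blast
next
  define C where "C = cubic (1 / a) (1 / b)"
  assume "\<exists>p q. ?R p q"
  then obtain p q where R: "?R p q" by blast
  show "pell_solvable (1 / a) (1 / b) (1 / \<gamma>) n"
  proof (cases "even n")
    case True
    then obtain m where m: "n = 2 * m" by blast
    with R have dp: "degree p = m"
      and ev: "\<And>s. (poly p s)\<^sup>2 - s * (s - 1 / a) * (s + 1 / b) * (s - 1 / \<gamma>) * (poly q s)\<^sup>2 = 1"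
      by auto
    \<comment> \<open>\<open>P\<close> and \<open>Q\<close> are the coefficients of the square of
      \<open>p + q * sqrt R\<close>, as in the double-angle formulas for \<open>cosh\<close> and
      \<open>sinh\<close>.\<close>
    define P where "P = smult 2 (p\<^sup>2) - 1"
    define Q where "Q = smult 2 (p * q)"
    have "p \<noteq> 0" using dp m n by auto
    then have "degree (smult 2 (p\<^sup>2)) = n" using dp m by (simp add: degree_power_eq)
    then have "degree P = n" unfolding P_def using n by (subst degree_diff_one) auto
    moreover have "poly (P\<^sup>2 - C * [:-(1 / \<gamma>), 1:] * Q\<^sup>2) s = poly 1 s" for s
      using ev [of s] unfolding P_def Q_def C_def poly_diff poly_mult poly_power poly_cubic poly_smult
      by simp algebra
    then have "P\<^sup>2 - C * [:-(1 / \<gamma>), 1:] * Q\<^sup>2 = 1"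
      by (rule poly_eq_by_eval)
    moreover have "poly P 0 = 1" "poly P (1 / a) = 1" "poly P (- (1 / b)) = 1"
      using ev [of 0] ev [of "1 / a"] ev [of "- (1 / b)"] unfolding P_def by simp_all
    ultimately show ?thesis unfolding pell_solvable_def C_def by blast
  next
    case False
    then obtain m where m: "n = 2 * m + 1" by (rule oddE)
    with R have dp: "degree p = m"
      and ev: "\<And>s. (s - 1 / \<gamma>) * (poly p s)\<^sup>2 - s * (s - 1 / a) * (s + 1 / b) * (poly q s)\<^sup>2 = - sgn \<gamma>"
      by auto
    have sg: "sgn \<gamma> * sgn \<gamma> = 1" using g by (auto simp: sgn_if)
    \<comment> \<open>The same doubling for a right-hand side \<open>- sgn \<gamma>\<close>; the
      factor \<open>- sgn \<gamma>\<close> makes \<open>P\<close> equal to 1 rather than -3 where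
      the cubic vanishes when \<open>\<gamma> > 0\<close>.\<close>
    define P where "P = smult (- 2 * sgn \<gamma>) ([:-(1 / \<gamma>), 1:] * p\<^sup>2) - 1"
    define Q where "Q = smult 2 (p * q)"
    have "p \<noteq> 0" using dp m n by auto
    then have "degree ([:-(1 / \<gamma>), 1:] * p\<^sup>2) = n"
      using dp m by (subst degree_mult_eq) (auto simp: degree_power_eq)
    then have "degree (smult (- 2 * sgn \<gamma>) ([:-(1 / \<gamma>), 1:] * p\<^sup>2)) = n"
      using g by (subst degree_smult_eq) (auto simp: sgn_if)
    then have "degree P = n" unfolding P_def using n by (subst degree_diff_one) auto
    moreover have "poly (P\<^sup>2 - C * [:-(1 / \<gamma>), 1:] * Q\<^sup>2) s = poly 1 s" for s
    proof -
      define X where "X = (s - 1 / \<gamma>) * (poly p s)\<^sup>2"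
      define Y where "Y = s * (s - 1 / a) * (s + 1 / b) * (poly q s)\<^sup>2"
      have "poly (P\<^sup>2 - C * [:-(1 / \<gamma>), 1:] * Q\<^sup>2) s = (- 2 * sgn \<gamma> * X - 1)\<^sup>2 - 4 * X * Y"
        unfolding P_def Q_def C_def X_def Y_def poly_diff poly_mult poly_power poly_cubic poly_smult
        by simp algebra
      also have "\<dots> = 1"
        using ev [of s, folded X_def Y_def] sg by algebra
      finally show ?thesis by simp
    qed
    then have "P\<^sup>2 - C * [:-(1 / \<gamma>), 1:] * Q\<^sup>2 = 1"
      by (rule poly_eq_by_eval)
    moreover have "poly P s = 1" if "s * (s - 1 / a) * (s + 1 / b) = 0" for s
    proof -
      have "poly P s = - 2 * sgn \<gamma> * ((s - 1 / \<gamma>) * (poly p s)\<^sup>2) - 1"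
        unfolding P_def by (simp add: algebra_simps)
      also have "(s - 1 / \<gamma>) * (poly p s)\<^sup>2 = - sgn \<gamma>" using ev [of s] that by simp
      finally show ?thesis using sg by (simp add: mult.assoc)
    qed
    then have "poly P 0 = 1" "poly P (1 / a) = 1" "poly P (- (1 / b)) = 1"
      by simp_all
    ultimately show ?thesis unfolding pell_solvable_def C_def by blast
  qed
qed

section \<open>The billiard map and its Lax matrix\<close>

text \<open>The product of the first \<open>k\<close> bounce matrices, applied to a column
  \<open>z\<close>. Each matrix is factored into a move of the position followed by a kick of the
  velocity; only the kick carries the factor \<open>s\<close>.\<close>

primrec transfer :: "(nat \<Rightarrow> real) \<Rightarrow> (nat \<Rightarrow> real) \<Rightarrow> real poly \<times> real poly \<Rightarrow> nat \<Rightarrow> real poly \<times> real poly" where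
  "transfer mu nu z 0 = z"
| "transfer mu nu z (Suc k) =
     (let (p, q) = transfer mu nu z k; p' = p + smult (mu k) q
      in (p', q + smult (nu k) (pCons 0 p')))"

text \<open>
  \<open>(x, y)\<close> are the vertices of a trajectory and \<open>(u, w)\<close> the outgoing velocities, scaled by
  the condition \<open>inward\<close>. With this scaling the condition of tangency to the caustic reads
  \<open>caustic\<close>, the next vertex is \<open>mu\<close> velocities away, and the reflection adds the
  multiple \<open>nu\<close> of the Minkowski normal \<open>(A x, -B y)\<close>.
\<close>

locale normalized_orbit =
  fixes A B g :: real and x y u w mu nu :: "nat \<Rightarrow> real"
  assumes A_pos: "A > 0" and B_pos: "B > 0" and g_nonzero: "g \<noteq> 0" and g_A: "g \<noteq> A" and g_B: "g \<noteq> -B"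
    and on_ellipse: "A * (x k)\<^sup>2 + B * (y k)\<^sup>2 = 1"
    and inward: "A * x k * u k + B * y k * w k = -1"
    and caustic: "A * B * ((u k)\<^sup>2 - (w k)\<^sup>2) = - g"
    and mu: "mu k * (A * (u k)\<^sup>2 + B * (w k)\<^sup>2) = 2"
    and nu: "nu k * (B\<^sup>2 * (y (Suc k))\<^sup>2 - A\<^sup>2 * (x (Suc k))\<^sup>2) = 2"
    and x_Suc: "x (Suc k) = x k + mu k * u k" and y_Suc: "y (Suc k) = y k + mu k * w k"
    and u_Suc: "u (Suc k) = u k + nu k * A * x (Suc k)"
    and w_Suc: "w (Suc k) = w k - nu k * B * y (Suc k)"
begin

text \<open>\<open>al\<close> is \<open>A * B\<close> times the Minkowski product of position and
  velocity. \<open>ka\<close> is the Minkowski square of the tangent direction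
  \<open>(- B * y, A * x)\<close>, so it vanishes where the tangent is light-like.\<close>

definition al :: "nat \<Rightarrow> real" where "al k = A * B * (x k * u k - y k * w k)"
definition be :: "nat \<Rightarrow> real" where "be k = A * (u k)\<^sup>2 + B * (w k)\<^sup>2"
definition ka :: "nat \<Rightarrow> real" where "ka k = B\<^sup>2 * (y k)\<^sup>2 - A\<^sup>2 * (x k)\<^sup>2"

text \<open>The Lax matrix is \<open>((L11, L12), (L21, -L11))\<close>.\<close>

definition L11 :: "nat \<Rightarrow> real \<Rightarrow> real" where "L11 k s = s * (s - al k)"
definition L12 :: "nat \<Rightarrow> real \<Rightarrow> real" where "L12 k s = A * B - ka k * s"
definition L21 :: "nat \<Rightarrow> real \<Rightarrow> real" where "L21 k s = s * (g - be k * s)"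

definition M11 :: "nat \<Rightarrow> real poly" where "M11 k = fst (transfer mu nu (1, 0) k)"
definition M21 :: "nat \<Rightarrow> real poly" where "M21 k = snd (transfer mu nu (1, 0) k)"
definition M12 :: "nat \<Rightarrow> real poly" where "M12 k = fst (transfer mu nu (0, 1) k)"
definition M22 :: "nat \<Rightarrow> real poly" where "M22 k = snd (transfer mu nu (0, 1) k)"

lemma M_0 [simp]: "M11 0 = 1" "M21 0 = 0" "M12 0 = 0" "M22 0 = 1"
  by (simp_all add: M11_def M21_def M12_def M22_def)

lemma M_Suc:
  "M11 (Suc k) = M11 k + smult (mu k) (M21 k)"
  "M12 (Suc k) = M12 k + smult (mu k) (M22 k)"
  "M21 (Suc k) = M21 k + smult (nu k) (pCons 0 (M11 (Suc k)))"
  "M22 (Suc k) = M22 k + smult (nu k) (pCons 0 (M12 (Suc k)))"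
  by (simp_all add: M11_def M21_def M12_def M22_def case_prod_unfold Let_def)

lemma mu_be: "mu k * be k = 2" and nu_ka: "nu k * ka (Suc k) = 2"
  using mu nu by (simp_all add: be_def ka_def)

lemma mu_nonzero: "mu k \<noteq> 0" and be_nonzero: "be k \<noteq> 0" and nu_nonzero: "nu k \<noteq> 0"
  and ka_Suc_nonzero: "ka (Suc k) \<noteq> 0"
  using mu_be [of k] nu_ka [of k] by auto

text \<open>These are the coefficients of \<open>s^3\<close> and \<open>s^2\<close> in the identity
  \<open>L_square\<close>; its other coefficients agree by construction.\<close>

lemma be_ka: "be k * ka k = 2 * al k + (B - A) - g"
  and al_square: "(al k)\<^sup>2 = be k * (A * B) + g * ka k - A * B - g * (B - A)"
proof -
  show "be k * ka k = 2 * al k + (B - A) - g"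
    unfolding be_def al_def ka_def using on_ellipse [of k] inward [of k] caustic [of k] by algebra
  show "(al k)\<^sup>2 = be k * (A * B) + g * ka k - A * B - g * (B - A)"
    unfolding be_def al_def ka_def using on_ellipse [of k] inward [of k] caustic [of k] by algebra
qed

lemma L_square: "(L11 k s)\<^sup>2 + L12 k s * L21 k s = s * (s - A) * (s + B) * (s - g)"
  unfolding L11_def L12_def L21_def using be_ka [of k] al_square [of k] by algebra

lemma ka_Suc: "ka (Suc k) = ka k - 2 * mu k * al k + (mu k)\<^sup>2 * g"
  unfolding ka_def al_def x_Suc y_Suc
  using on_ellipse [of k] on_ellipse [of "Suc k", unfolded x_Suc y_Suc] caustic [of k] by algebra

lemma al_Suc: "al (Suc k) = al k - mu k * g + nu k * (A * B)"
  unfolding al_def u_Suc w_Suc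
  using on_ellipse [of "Suc k"] caustic [of k] unfolding x_Suc y_Suc by algebra

lemma be_Suc: "be (Suc k) = be k + nu k * (al (Suc k) + al k - mu k * g)"
proof -
  \<comment> \<open>\<open>be_ka\<close> at both vertices determines \<open>be (Suc k)\<close> up to
    the nonzero factor \<open>ka (Suc k)\<close>, which is then cancelled.\<close>
  have "ka (Suc k) * (be (Suc k) - be k - nu k * (al (Suc k) + al k - mu k * g)) = 0"
    using be_ka [of k] be_ka [of "Suc k"] ka_Suc [of k] al_Suc [of k] mu_be [of k] nu_ka [of k]
    by algebra
  then show ?thesis using ka_Suc_nonzero [of k] by simp
qed

text \<open>The relation \<open>T L = L' T\<close>, applied to a column \<open>(p, q)\<close> and
  read off by components.\<close>

lemma Lax_step:
  assumes "p' = p + mu k * q" "q' = q + nu k * s * p'"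
  shows "L11 (Suc k) s * p' + L12 (Suc k) s * q'
      = (L11 k s * p + L12 k s * q) + mu k * (L21 k s * p - L11 k s * q)"
    and "L21 (Suc k) s * p' - L11 (Suc k) s * q'
      = (L21 k s * p - L11 k s * q)
        + nu k * s * ((L11 k s * p + L12 k s * q) + mu k * (L21 k s * p - L11 k s * q))"
  unfolding L11_def L12_def L21_def assms
  using be_Suc [of k] ka_Suc [of k] al_Suc [of k] mu_be [of k] nu_ka [of k] by algebra+

section \<open>Action of the accumulated matrix on columns\<close>

definition pos :: "nat \<Rightarrow> real \<Rightarrow> real \<Rightarrow> real \<Rightarrow> real" where
  "pos k s p q = poly (M11 k) s * p + poly (M12 k) s * q"

definition vel :: "nat \<Rightarrow> real \<Rightarrow> real \<Rightarrow> real \<Rightarrow> real" where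
  "vel k s p q = poly (M21 k) s * p + poly (M22 k) s * q"

lemma pos_Suc: "pos (Suc k) s p q = pos k s p q + mu k * vel k s p q"
  and vel_Suc: "vel (Suc k) s p q = vel k s p q + nu k * s * pos (Suc k) s p q"
  by (simp_all add: pos_def vel_def M_Suc algebra_simps)

lemma pos_0 [simp]: "pos 0 s p q = p" and vel_0 [simp]: "vel 0 s p q = q"
  by (simp_all add: pos_def vel_def)

text \<open>Iterating \<open>Lax_step\<close> intertwines the Lax matrices at times 0 and
  \<open>k\<close> through the accumulated matrix.\<close>

lemma Lax:
  "L11 k s * pos k s p q + L12 k s * vel k s p q
     = pos k s (L11 0 s * p + L12 0 s * q) (L21 0 s * p - L11 0 s * q)" (is "?a k")
  "L21 k s * pos k s p q - L11 k s * vel k s p q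
     = vel k s (L11 0 s * p + L12 0 s * q) (L21 0 s * p - L11 0 s * q)" (is "?b k")
proof -
  have "?a k \<and> ?b k"
  proof (induction k)
    case (Suc k)
    then show ?case
      using Lax_step [OF pos_Suc [of k s p q] vel_Suc [of k s p q]]
      by (metis pos_Suc vel_Suc)
  qed simp
  then show "?a k" "?b k" by auto
qed

lemma M_det: "poly (M11 k) s * poly (M22 k) s - poly (M12 k) s * poly (M21 k) s = 1"
proof (induction k)
  case (Suc k)
  then show ?case unfolding M_Suc poly_add poly_smult poly_pCons by algebra
qed simp

lemma M_at_0: "poly (M11 k) 0 = 1" "poly (M21 k) 0 = 0" "poly (M22 k) 0 = 1"
  by (induction k) (simp_all add: M_Suc)

lemma degree_M:
  "degree (M11 k) \<le> k - 1" "degree (M12 k) \<le> k - 1" "degree (M21 k) \<le> k" "degree (M22 k) \<le> k"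
proof -
  have "degree (M11 k) \<le> k - 1 \<and> degree (M12 k) \<le> k - 1 \<and> degree (M21 k) \<le> k \<and> degree (M22 k) \<le> k"
  proof (induction k)
    case (Suc k)
    then have *: "degree (M11 (Suc k)) \<le> k" "degree (M12 (Suc k)) \<le> k"
      unfolding M_Suc by (auto intro!: degree_add_le order.trans [OF degree_smult_le])
    moreover have "degree (M21 (Suc k)) \<le> Suc k" "degree (M22 (Suc k)) \<le> Suc k"
      unfolding M_Suc(3,4) using Suc *
      by (auto intro!: degree_add_le order.trans [OF degree_smult_le] order.trans [OF degree_pCons_le])
    ultimately show ?case by simp
  qed simp
  then show "degree (M11 k) \<le> k - 1" "degree (M12 k) \<le> k - 1" "degree (M21 k) \<le> k" "degree (M22 k) \<le> k"
    by auto
qed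

text \<open>The top coefficient comes only from multiplying the terms \<open>s * mu j * nu j\<close>
  in the lower right corners. As \<open>M11\<close> stays below degree \<open>k\<close> for
  \<open>k > 0\<close>, the trace has exact degree \<open>k\<close>.\<close>

lemma coeff_M22: "coeff (M22 k) k = (\<Prod>j<k. mu j * nu j)"
proof (induction k)
  case (Suc k)
  have "coeff (M22 k) (Suc k) = 0"
    using degree_M(4) [of k] by (intro coeff_eq_0) simp
  moreover have "coeff (M12 k) k = 0"
    using degree_M(2) [of k] by (cases k) (auto intro: coeff_eq_0)
  ultimately show ?case using Suc by (simp add: M_Suc)
qed simp

lemma degree_trace:
  assumes "n > 0"
  shows "degree (M11 n + M22 n) = n"
proof (rule antisym)
  show "degree (M11 n + M22 n) \<le> n"
    using degree_M [of n] by (intro degree_add_le) auto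
  have "coeff (M11 n) n = 0"
    using degree_M(1) [of n] assms by (intro coeff_eq_0) simp
  then have "coeff (M11 n + M22 n) n \<noteq> 0"
    using mu_nonzero nu_nonzero by (simp add: coeff_M22)
  then show "n \<le> degree (M11 n + M22 n)" by (rule le_degree)
qed

lemma orbit_pos_vel:
  "x k = pos k A (x 0) (u 0)" "u k = vel k A (x 0) (u 0)"
  "y k = pos k (-B) (y 0) (w 0)" "w k = vel k (-B) (y 0) (w 0)"
proof -
  have "x k = pos k A (x 0) (u 0) \<and> u k = vel k A (x 0) (u 0) \<and>
    y k = pos k (-B) (y 0) (w 0) \<and> w k = vel k (-B) (y 0) (w 0)"
    by (induction k) (simp_all add: pos_Suc vel_Suc x_Suc y_Suc u_Suc w_Suc)
  then show "x k = pos k A (x 0) (u 0)" "u k = vel k A (x 0) (u 0)"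
    "y k = pos k (-B) (y 0) (w 0)" "w k = vel k (-B) (y 0) (w 0)" by auto
qed

text \<open>On these vectors \<open>P + Q L\<close> acts as the scalar \<open>P\<close>; this links
  closing of the orbit to the values of \<open>P\<close> at \<open>A\<close> and
  \<open>-B\<close>.\<close>

lemma L_kernel:
  "L11 k A * x k + L12 k A * u k = 0" "L21 k A * x k - L11 k A * u k = 0"
  "L11 k (-B) * y k + L12 k (-B) * w k = 0" "L21 k (-B) * y k - L11 k (-B) * w k = 0"
  unfolding L11_def L12_def L21_def al_def be_def ka_def
  using on_ellipse [of k] inward [of k] caustic [of k] by algebra+

text \<open>A chord along a coordinate axis would force the degenerate value \<open>g = A\<close> or
  \<open>g = -B\<close>.\<close>

lemma coordinates_nonzero: "x k \<noteq> 0 \<or> u k \<noteq> 0" "y k \<noteq> 0 \<or> w k \<noteq> 0"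
proof -
  show "x k \<noteq> 0 \<or> u k \<noteq> 0"
  proof (rule ccontr)
    assume "\<not> (x k \<noteq> 0 \<or> u k \<noteq> 0)"
    then have "g = A" using on_ellipse [of k] inward [of k] caustic [of k] by algebra
    then show False using g_A by simp
  qed
  show "y k \<noteq> 0 \<or> w k \<noteq> 0"
  proof (rule ccontr)
    assume "\<not> (y k \<noteq> 0 \<or> w k \<noteq> 0)"
    then have "g = - B" using on_ellipse [of k] inward [of k] caustic [of k] by algebra
    then show False using g_B by simp
  qed
qed

text \<open>If \<open>L\<close> vanished at \<open>s\<close>, its square would give \<open>R\<close>
  a double zero at \<open>s\<close>. The three distinct nonzero roots \<open>A\<close>,
  \<open>-B\<close>, \<open>g\<close> would then have to lie among the two numbers \<open>s\<close>
  and \<open>- ka k * be k\<close>.\<close>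

lemma L_not_all_zero:
  assumes "L11 k s = 0" "L12 k s = 0" "L21 k s = 0"
  shows False
proof -
  have s: "s \<noteq> 0" using assms(2) A_pos B_pos by (auto simp: L12_def)
  then have c: "al k = s" "be k * s = g" "ka k * s = A * B"
    using assms by (auto simp: L11_def L12_def L21_def)
  have R: "t * (t - A) * (t + B) * (t - g) = (t - s)\<^sup>2 * t * (t + ka k * be k)" for t
    using L_square [of k t] c unfolding L11_def L12_def L21_def by algebra
  have "s = A \<or> A + ka k * be k = 0" using R [of A] A_pos by auto
  moreover have "s = -B \<or> - B + ka k * be k = 0" using R [of "-B"] B_pos by auto
  moreover have "s = g \<or> g + ka k * be k = 0" using R [of g] g_nonzero by auto
  ultimately show False using A_pos B_pos g_A g_B by auto
qed

definition l11 :: "nat \<Rightarrow> real poly" where "l11 k = [:0, - al k, 1:]"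
definition l12 :: "nat \<Rightarrow> real poly" where "l12 k = [:A * B, - ka k:]"
definition l21 :: "nat \<Rightarrow> real poly" where "l21 k = [:0, g, - be k:]"

lemma poly_l: "poly (l11 k) s = L11 k s" "poly (l12 k) s = L12 k s" "poly (l21 k) s = L21 k s"
  by (simp_all add: l11_def l12_def l21_def L11_def L12_def L21_def algebra_simps)

text \<open>The entries of \<open>M L = L M\<close> make \<open>M - P\<close> proportional to
  \<open>L\<close>, with \<open>P\<close> half the trace. The factor \<open>Q\<close> is a
  polynomial because the root \<open>z\<close> of the linear entry \<open>L12\<close> is also a root
  of \<open>M12\<close>. The determinant of \<open>M\<close> then yields the Pell equation.\<close>

lemma periodic_imp_pell_solvable:
  assumes n: "n > 0" and per: "x n = x 0" "y n = y 0" "u n = u 0" "w n = w 0"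
  shows "pell_solvable A B g n"
proof -
  have L_n: "L11 n s = L11 0 s" "L12 n s = L12 0 s" "L21 n s = L21 0 s" for s
    unfolding L11_def L12_def L21_def al_def be_def ka_def per by auto
  have c1: "poly (M12 n) s * L21 0 s = L12 0 s * poly (M21 n) s" for s
    using Lax(1) [of n s 1 0] unfolding L_n pos_def vel_def by (simp add: algebra_simps)
  have c2: "(poly (M11 n) s - poly (M22 n) s) * L12 0 s = 2 * L11 0 s * poly (M12 n) s" for s
    using Lax(1) [of n s 0 1] unfolding L_n pos_def vel_def by (simp add: algebra_simps)
  \<comment> \<open>Only vertices with positive index are known to have non-light-like tangent;
    periodicity carries this over from vertex \<open>n\<close> to vertex 0.\<close>
  have ka0: "ka 0 \<noteq> 0"
    using ka_Suc_nonzero [of "n - 1"] n per by (simp add: ka_def)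
  define z where "z = A * B / ka 0"
  have z: "L12 0 z = 0" using ka0 by (simp add: L12_def z_def)
  have "poly (M12 n) z = 0"
    using c1 [of z] c2 [of z] L_not_all_zero [of 0 z] z by auto
  then obtain Q0 where Q0: "M12 n = [:-z, 1:] * Q0"
    by (auto simp: poly_eq_0_iff_dvd elim: dvdE)
  define Q where "Q = smult (- 1 / ka 0) Q0"
  have l12: "l12 0 = smult (- ka 0) [:-z, 1:]"
    using ka0 by (simp add: l12_def z_def)
  have M12: "M12 n = Q * l12 0"
    unfolding l12 Q_def Q0 using ka0 by simp
  have l12_nz: "l12 0 \<noteq> 0" using ka0 by (simp add: l12_def)
  have "l12 0 * M21 n = l12 0 * (Q * l21 0)"
  proof (rule poly_eq_by_eval)
    show "poly (l12 0 * M21 n) s = poly (l12 0 * (Q * l21 0)) s" for s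
      using c1 [of s] by (auto simp: M12 poly_l mult_ac)
  qed
  then have M21: "M21 n = Q * l21 0" using l12_nz by (metis mult_left_cancel)
  have "l12 0 * (M11 n - M22 n) = l12 0 * (smult 2 (Q * l11 0))"
  proof (rule poly_eq_by_eval)
    show "poly (l12 0 * (M11 n - M22 n)) s = poly (l12 0 * (smult 2 (Q * l11 0))) s" for s
      using c2 [of s] by (auto simp: M12 poly_l mult_ac)
  qed
  then have M11: "M11 n - M22 n = smult 2 (Q * l11 0)" using l12_nz by (metis mult_left_cancel)
  define P where "P = smult (1 / 2) (M11 n + M22 n)"
  have ev11: "poly (M11 n) s = poly P s + poly Q s * L11 0 s" for s
    using arg_cong [OF M11, of "\<lambda>p. poly p s"] by (simp add: P_def poly_l field_simps)
  have ev22: "poly (M22 n) s = poly P s - poly Q s * L11 0 s" for s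
    using arg_cong [OF M11, of "\<lambda>p. poly p s"] by (simp add: P_def poly_l field_simps)
  have ev12: "poly (M12 n) s = poly Q s * L12 0 s" and ev21: "poly (M21 n) s = poly Q s * L21 0 s" for s
    unfolding M12 M21 by (simp_all add: poly_l)
  have "degree P = n" unfolding P_def using degree_trace [OF n] by simp
  moreover have "P\<^sup>2 - cubic A B * [:-g, 1:] * Q\<^sup>2 = 1"
  proof (rule poly_eq_by_eval)
    fix s
    have "poly (P\<^sup>2 - cubic A B * [:-g, 1:] * Q\<^sup>2) s
        = (poly P s)\<^sup>2 - s * (s - A) * (s + B) * (s - g) * (poly Q s)\<^sup>2"
      by (simp add: poly_cubic algebra_simps)
    also have "\<dots> = 1"
      using M_det [of n s] L_square [of 0 s] unfolding ev11 ev12 ev21 ev22 by algebra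
    finally show "poly (P\<^sup>2 - cubic A B * [:-g, 1:] * Q\<^sup>2) s = poly 1 s" by simp
  qed
  moreover have "poly P 0 = 1" unfolding P_def by (simp add: M_at_0)
  \<comment> \<open>\<open>M\<close> fixes the vector \<open>(x 0, u 0)\<close> by periodicity, and
    acts on it as the scalar \<open>poly P A\<close> by \<open>L_kernel\<close>.\<close>
  moreover have "poly P A = 1"
  proof -
    have "poly P A * x 0 = x 0" "poly P A * u 0 = u 0"
      using orbit_pos_vel(1,2) [of n] L_kernel(1,2) [of 0] unfolding pos_def vel_def per ev11 ev12 ev21 ev22
      by algebra+
    then show ?thesis using coordinates_nonzero(1) [of 0] by auto
  qed
  moreover have "poly P (-B) = 1"
  proof -
    have "poly P (-B) * y 0 = y 0" "poly P (-B) * w 0 = w 0"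
      using orbit_pos_vel(3,4) [of n] L_kernel(3,4) [of 0] unfolding pos_def vel_def per ev11 ev12 ev21 ev22
      by algebra+
    then show ?thesis using coordinates_nonzero(2) [of 0] by auto
  qed
  ultimately show ?thesis unfolding pell_solvable_def by blast
qed

end

section \<open>Behaviour at infinity\<close>

lemma bigo_power_cancel:
  fixes f h :: "real \<Rightarrow> real"
  assumes "(\<lambda>s. f s * s ^ m) \<in> O(\<lambda>s. h s * s ^ m)"
  shows "f \<in> O(h)"
proof -
  obtain c where "\<forall>\<^sub>F s in at_top. norm (f s * s ^ m) \<le> c * norm (h s * s ^ m)"
    using assms by (rule landau_o.bigE)
  moreover have "\<forall>\<^sub>F s::real in at_top. s > 0" by (rule eventually_gt_at_top)
  ultimately have "\<forall>\<^sub>F s in at_top. norm (f s) \<le> c * norm (h s)"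
    by eventually_elim (simp add: abs_mult)
  then show ?thesis by (rule bigoI)
qed

lemma poly_bigtheta:
  fixes p :: "real poly"
  assumes "p \<noteq> 0"
  shows "poly p \<in> \<Theta>(\<lambda>s. s ^ degree p)"
proof -
  have "((\<lambda>s. poly p s / s ^ degree p) \<longlongrightarrow> lead_coeff p) at_top"
    using poly_divide_tendsto_aux [of p] at_top_le_at_infinity by (rule filterlim_mono [OF _ order_refl])
  then show ?thesis
    using assms by (intro bigthetaI_tendsto) (auto intro: eventually_mono [OF eventually_gt_at_top [of 0]])
qed

lemma power_bigo:
  assumes "m \<le> n"
  shows "(\<lambda>s::real. s ^ m) \<in> O(\<lambda>s. s ^ n)"
proof (rule bigoI [of _ 1])
  show "\<forall>\<^sub>F s::real in at_top. norm (s ^ m) \<le> 1 * norm (s ^ n)"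
    using eventually_ge_at_top [of 1] by eventually_elim (use assms in \<open>simp add: power_increasing\<close>)
qed

lemma poly_bigo:
  fixes p :: "real poly"
  assumes "degree p \<le> n"
  shows "poly p \<in> O(\<lambda>s. s ^ n)"
proof (cases "p = 0")
  case True
  have "poly p = (\<lambda>_. 0)" using True by auto
  then show ?thesis by simp
next
  case False
  have "(\<lambda>s::real. s ^ degree p) \<in> O(\<lambda>s. s ^ n)" using assms by (rule power_bigo)
  then show ?thesis using poly_bigtheta [OF False] by (meson landau_o.big.trans bigthetaD1)
qed

lemma poly_bounded_imp_const:
  fixes p :: "real poly"
  assumes "poly p \<in> O(\<lambda>_. 1)"
  shows "degree p = 0"
proof (cases "p = 0")
  case False
  then have "(\<lambda>s::real. s ^ degree p) \<in> O(\<lambda>_. 1)"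
    using bigthetaD2 [OF poly_bigtheta [OF False]] assms
    by (auto simp: bigomega_iff_bigo intro: landau_o.big.trans)
  then obtain c where "\<forall>\<^sub>F s::real in at_top. norm (s ^ degree p) \<le> c * norm (1::real)"
    by (rule landau_o.bigE)
  moreover have "\<forall>\<^sub>F s::real in at_top. s > max 1 c" by (rule eventually_gt_at_top)
  ultimately have "\<forall>\<^sub>F s::real in at_top. s > max 1 c \<and> norm (s ^ degree p) \<le> c"
    by eventually_elim simp
  then obtain s :: real where "s > 1" "s > c" "s ^ degree p \<le> c"
    by (auto dest!: eventually_happens)
  then have "\<not> degree p > 0"
    using self_le_power [of s "degree p"] by auto
  then show ?thesis by simp
qed simp

text \<open>The entries of \<open>N M\<^sup>-\<^sup>1\<close> are determinants of a row \<open>r\<close> of \<open>N\<close> and a row \<open>m\<close> of \<open>M\<close>.\<close>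

lemma row_det_const:
  fixes r1 r2 m1 m2 :: "real poly" and e1 e2 :: "real \<Rightarrow> real"
  assumes "degree r1 \<le> n" "degree r2 \<le> n" "degree m1 \<le> n" "degree m2 \<le> n"
    and r: "(\<lambda>s. (poly r1 s * e1 s + poly r2 s * e2 s) * s ^ n) \<in> O(\<lambda>s. s\<^sup>2)"
    and m: "(\<lambda>s. (poly m1 s * e1 s + poly m2 s * e2 s) * s ^ n) \<in> O(\<lambda>s. s\<^sup>2)"
    and e: "(\<lambda>s. s\<^sup>2) \<in> O(e1)"
  shows "poly (r1 * m2 - r2 * m1) s = poly (r1 * m2 - r2 * m1) 0"
proof -
  define k where "k = r1 * m2 - r2 * m1"
  have "(\<lambda>s. poly k s * s\<^sup>2 * s ^ n) \<in> O(\<lambda>s. poly k s * e1 s * s ^ n)"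
    using e by (intro landau_o.big.mult) auto
  \<comment> \<open>Cramer's rule: \<open>e2\<close> is eliminated from the products of the two rows
    with the vector \<open>(e1, e2)\<close>.\<close>
  also have "(\<lambda>s. poly k s * e1 s * s ^ n)
     = (\<lambda>s. poly m2 s * ((poly r1 s * e1 s + poly r2 s * e2 s) * s ^ n)
         - poly r2 s * ((poly m1 s * e1 s + poly m2 s * e2 s) * s ^ n))"
    by (simp add: k_def algebra_simps)
  also have "\<dots> \<in> O(\<lambda>s. s ^ n * s\<^sup>2)"
    using assms by (intro sum_in_bigo landau_o.big.mult poly_bigo)
  finally have "(\<lambda>s. poly k s * s\<^sup>2 * s ^ n) \<in> O(\<lambda>s. s ^ n * s\<^sup>2)" .
  moreover have "(\<lambda>s. poly k s * s\<^sup>2 * s ^ n) = (\<lambda>s. poly k s * s ^ (2 + n))"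
    "(\<lambda>s::real. s ^ n * s\<^sup>2) = (\<lambda>s. 1 * s ^ (2 + n))"
    by (auto simp: power_add power2_eq_square mult_ac)
  ultimately have "(\<lambda>s. poly k s * s ^ (2 + n)) \<in> O(\<lambda>s. 1 * s ^ (2 + n))"
    by (simp only:)
  then have "poly k \<in> O(\<lambda>_. 1)" by (rule bigo_power_cancel)
  then have "degree k = 0" by (rule poly_bounded_imp_const)
  then show ?thesis unfolding k_def [symmetric] by (auto elim: degree_eq_zeroE)
qed

text \<open>Applied to \<open>P * Q\<close>, to decide which sign of \<open>Q\<close> to
  take.\<close>

lemma eventually_poly_sign:
  fixes p :: "real poly"
  shows "(\<forall>\<^sub>F s in at_top. poly p s \<ge> 0) \<or> (\<forall>\<^sub>F s in at_top. poly p s \<le> 0)"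
proof -
  have *: "\<forall>\<^sub>F s in at_top. poly q s \<ge> 0" if q: "lead_coeff q > 0" for q :: "real poly"
  proof -
    obtain N where N: "\<forall>s\<ge>N. poly q s \<ge> lead_coeff q" using poly_pinfty_gt_lc [OF q] by blast
    show ?thesis using eventually_ge_at_top [of N] by eventually_elim (use N q in force)
  qed
  consider "lead_coeff p > 0" | "lead_coeff (-p) > 0" | "p = 0"
    by (cases "lead_coeff p" "0::real" rule: linorder_cases) auto
  then show ?thesis
  proof cases
    case 2
    then show ?thesis using * [OF 2] by auto
  qed (auto dest: *)
qed

section \<open>Closing of the orbit from a solution of the Pell equation\<close>

context normalized_orbit
begin

text \<open>The hypothesis \<open>sign\<close> selects, from the two factors
  \<open>P + Q * Y\<close> and \<open>P - Q * Y\<close> with product 1, the first as the one that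
  decays at infinity, to match the decay of \<open>M\<close> on the same eigenvector.\<close>

lemma pell_solution_imp_periodic:
  assumes P: "degree P = n" and PQ: "P\<^sup>2 - cubic A B * [:-g, 1:] * Q\<^sup>2 = 1"
    and P0: "poly P 0 = 1" "poly P A = 1" "poly P (-B) = 1"
    and sign: "\<forall>\<^sub>F s in at_top. poly P s * poly Q s \<le> 0"
  shows "x n = x 0 \<and> y n = y 0"
proof -
  define R where "R s = s * (s - A) * (s + B) * (s - g)" for s
  define Y where "Y s = sqrt (R s)" for s
  \<comment> \<open>\<open>(e1, e2)\<close> is the eigenvector of \<open>L\<close> for \<open>Y = sqrt R\<close>; both \<open>M\<close> and \<open>N\<close> shrink it by \<open>s ^ n\<close>.\<close>
  define e1 where "e1 s = Y s + L11 0 s" for s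
  define e2 where "e2 s = L21 0 s" for s
  have PQ': "(poly P s)\<^sup>2 - R s * (poly Q s)\<^sup>2 = 1" for s
    using arg_cong [OF PQ, of "\<lambda>p. poly p s"] by (simp add: poly_cubic R_def algebra_simps)
  have big: "\<forall>\<^sub>F s in at_top. s > 0 \<and> (Y s)\<^sup>2 = R s \<and> Y s \<ge> 0"
    using eventually_gt_at_top [of "max (max 0 A) g"]
  proof eventually_elim
    case (elim s)
    then have "R s \<ge> 0" using B_pos by (auto simp: R_def)
    then show ?case using elim by (auto simp: Y_def)
  qed
  \<comment> \<open>\<open>R\<close> and \<open>s^4\<close> differ by a cubic, and
    \<open>Y - s^2\<close> is that difference divided by \<open>Y + s^2\<close>.\<close>
  have Y_approx: "(\<lambda>s. Y s - s\<^sup>2) \<in> O(\<lambda>s. s)"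
  proof -
    have "poly [:0, A * B * g, - A * B - g * (B - A), B - A - g:] \<in> O(\<lambda>s. s ^ 3)"
      by (intro poly_bigo) simp
    also have "poly [:0, A * B * g, - A * B - g * (B - A), B - A - g:] = (\<lambda>s. R s - s ^ 4)"
      by (auto simp: R_def algebra_simps power_numeral_reduce)
    finally have R4: "(\<lambda>s. R s - s ^ 4) \<in> O(\<lambda>s. s ^ 3)" .
    have "(\<lambda>s. (Y s - s\<^sup>2) * s ^ 2) \<in> O(\<lambda>s. R s - s ^ 4)"
    proof (rule bigoI [of _ 1])
      show "\<forall>\<^sub>F s in at_top. norm ((Y s - s\<^sup>2) * s ^ 2) \<le> 1 * norm (R s - s ^ 4)"
        using big
      proof eventually_elim
        case (elim s)
        then have "(Y s)\<^sup>2 = R s" by simp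
        then have "R s - s ^ 4 = (Y s - s\<^sup>2) * (Y s + s\<^sup>2)"
          by (simp add: power2_eq_square power4_eq_xxxx algebra_simps)
        then show ?case using elim by (simp add: abs_mult mult_left_mono)
      qed
    qed
    also note R4
    finally have "(\<lambda>s. (Y s - s\<^sup>2) * s ^ 2) \<in> O(\<lambda>s. s * s ^ 2)"
      by (simp add: power_numeral_reduce mult_ac)
    then show ?thesis by (rule bigo_power_cancel)
  qed
  \<comment> \<open>A lower bound for the first component of the eigenvector at any time
    \<open>k\<close>; it permits division by it below.\<close>
  have den: "(\<lambda>s. s\<^sup>2) \<in> O(\<lambda>s. Y s + L11 k s)" for k
  proof (rule bigoI [of _ 2])
    show "\<forall>\<^sub>F s in at_top. norm (s\<^sup>2) \<le> 2 * norm (Y s + L11 k s)"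
      using big eventually_gt_at_top [of "2 * \<bar>al k\<bar>"]
    proof eventually_elim
      case (elim s)
      then have "0 \<le> s * (s - 2 * al k)" by (intro mult_nonneg_nonneg) auto
      moreover have "s\<^sup>2 + s * (s - 2 * al k) + 2 * Y s = 2 * (Y s + L11 k s)"
        by (simp add: L11_def power2_eq_square algebra_simps)
      ultimately have "s\<^sup>2 \<le> 2 * (Y s + L11 k s)" using elim by linarith
      then show ?case using abs_ge_self [of "Y s + L11 k s"] by simp
    qed
  qed
  have s_sq: "(\<lambda>s::real. s) \<in> O(\<lambda>s. s\<^sup>2)" using power_bigo [of 1 2] by simp
  have e1: "e1 \<in> O(\<lambda>s. s\<^sup>2)"
  proof -
    have "poly [:0, - al 0, 2:] \<in> O(\<lambda>s. s\<^sup>2)" by (intro poly_bigo) simp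
    with landau_o.big.trans [OF Y_approx s_sq]
    have "(\<lambda>s. (Y s - s\<^sup>2) + poly [:0, - al 0, 2:] s) \<in> O(\<lambda>s. s\<^sup>2)" by (rule sum_in_bigo)
    then show ?thesis by (simp add: e1_def [abs_def] L11_def power2_eq_square algebra_simps)
  qed
  have L21: "L21 k \<in> O(\<lambda>s. s\<^sup>2)" for k
  proof -
    have "degree (l21 k) \<le> 2" by (simp add: l21_def)
    moreover have "poly (l21 k) = L21 k" by (auto simp: poly_l)
    ultimately show ?thesis by (metis poly_bigo)
  qed
  have e2: "e2 \<in> O(\<lambda>s. s\<^sup>2)" using L21 [of 0] by (simp add: e2_def [abs_def])
  define Z1 where "Z1 k s = pos k s (e1 s) (e2 s)" for k s
  define Z2 where "Z2 k s = vel k s (e1 s) (e2 s)" for k s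
  \<comment> \<open>By the Lax relation \<open>(Z1 k, Z2 k)\<close> is again an eigenvector for
    \<open>Y\<close>, now of the Lax matrix at time \<open>k\<close>, so its two components are in a
    known ratio.\<close>
  have eig: "\<forall>\<^sub>F s in at_top. Z2 k s * (Y s + L11 k s) = L21 k s * Z1 k s" for k
    using big
  proof eventually_elim
    case (elim s)
    then have YY: "(Y s)\<^sup>2 = R s" by simp
    have E: "L11 0 s * e1 s + L12 0 s * e2 s = Y s * e1 s" "L21 0 s * e1 s - L11 0 s * e2 s = Y s * e2 s"
      using L_square [of 0 s] YY unfolding e1_def e2_def R_def by (algebra, simp add: algebra_simps)
    have "L21 k s * Z1 k s - L11 k s * Z2 k s = vel k s (Y s * e1 s) (Y s * e2 s)"
      using Lax(2) [of k s "e1 s" "e2 s"] unfolding E Z1_def Z2_def .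
    also have "\<dots> = Y s * Z2 k s" unfolding Z2_def vel_def by algebra
    finally show ?case by algebra
  qed
  \<comment> \<open>One bounce multiplies \<open>Z1\<close> by \<open>v / (Y + L11 k)\<close>. The
    terms of order \<open>s^2\<close> in \<open>v\<close> cancel because
    \<open>mu k * be k = 2\<close>, so every bounce gains a factor of order
    \<open>1 / s\<close>.\<close>
  have Z1: "(\<lambda>s. Z1 k s * s ^ k) \<in> O(\<lambda>s. s\<^sup>2)" for k
  proof (induction k)
    case 0
    then show ?case using e1 by (simp add: Z1_def)
  next
    case (Suc k)
    define v where "v s = Y s + L11 k s + mu k * L21 k s" for s
    have "(\<lambda>s. (Y s - s\<^sup>2) + (mu k * g - al k) * s) \<in> O(\<lambda>s. s)"
      by (rule sum_in_bigo(1) [OF Y_approx]) simp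
    also have "(\<lambda>s. (Y s - s\<^sup>2) + (mu k * g - al k) * s) = v"
    proof
      show "(Y s - s\<^sup>2) + (mu k * g - al k) * s = v s" for s
      proof -
        have "v s = Y s + s\<^sup>2 - al k * s + mu k * g * s - (mu k * be k) * s\<^sup>2"
          by (simp add: v_def L11_def L21_def power2_eq_square algebra_simps)
        then show ?thesis unfolding mu_be by (simp add: algebra_simps)
      qed
    qed
    finally have v: "v \<in> O(\<lambda>s. s)" .
    have "(\<lambda>s. Z1 (Suc k) s * s ^ Suc k * s ^ 2) \<in> O(\<lambda>s. Z1 (Suc k) s * s ^ Suc k * (Y s + L11 k s))"
      using den [of k] by (intro landau_o.big.mult) auto
    also have "(\<lambda>s. Z1 (Suc k) s * s ^ Suc k * (Y s + L11 k s)) \<in> O(\<lambda>s. (Z1 k s * s ^ k) * (s * v s))"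
    proof (rule bigoI [of _ 1])
      show "\<forall>\<^sub>F s in at_top. norm (Z1 (Suc k) s * s ^ Suc k * (Y s + L11 k s)) \<le> 1 * norm ((Z1 k s * s ^ k) * (s * v s))"
        using eig [of k]
      proof eventually_elim
        case (elim s)
        have "Z1 (Suc k) s = Z1 k s + mu k * Z2 k s"
          unfolding Z1_def Z2_def by (rule pos_Suc)
        then have "Z1 (Suc k) s * (Y s + L11 k s) = Z1 k s * v s"
          using elim unfolding v_def by algebra
        then have "Z1 (Suc k) s * s ^ Suc k * (Y s + L11 k s) = (Z1 k s * s ^ k) * (s * v s)"
          by (simp add: mult_ac)
        then show ?case by (simp only: mult_1 order_refl)
      qed
    qed
    also have "(\<lambda>s. (Z1 k s * s ^ k) * (s * v s)) \<in> O(\<lambda>s. s\<^sup>2 * (s * s))"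
      using Suc v by (intro landau_o.big.mult) auto
    finally have "(\<lambda>s. Z1 (Suc k) s * s ^ Suc k * s ^ 2) \<in> O(\<lambda>s. s\<^sup>2 * s ^ 2)"
      by (simp add: power2_eq_square)
    then show ?case by (rule bigo_power_cancel)
  qed
  have Z2: "(\<lambda>s. Z2 k s * s ^ k) \<in> O(\<lambda>s. s\<^sup>2)" for k
  proof -
    have "(\<lambda>s. Z2 k s * s ^ k * s ^ 2) \<in> O(\<lambda>s. Z2 k s * s ^ k * (Y s + L11 k s))"
      using den [of k] by (intro landau_o.big.mult) auto
    also have "(\<lambda>s. Z2 k s * s ^ k * (Y s + L11 k s)) \<in> O(\<lambda>s. (Z1 k s * s ^ k) * L21 k s)"
    proof (rule bigoI [of _ 1])
      show "\<forall>\<^sub>F s in at_top. norm (Z2 k s * s ^ k * (Y s + L11 k s)) \<le> 1 * norm ((Z1 k s * s ^ k) * L21 k s)"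
        using eig [of k]
      proof eventually_elim
        case (elim s)
        have "Z2 k s * s ^ k * (Y s + L11 k s) = s ^ k * (Z2 k s * (Y s + L11 k s))"
          by (simp only: mult_ac)
        then have "Z2 k s * s ^ k * (Y s + L11 k s) = (Z1 k s * s ^ k) * L21 k s"
          unfolding elim by (simp only: mult_ac)
        then show ?case by (simp only: mult_1 order_refl)
      qed
    qed
    also have "(\<lambda>s. (Z1 k s * s ^ k) * L21 k s) \<in> O(\<lambda>s. s\<^sup>2 * s ^ 2)"
      using Z1 L21 by (intro landau_o.big.mult) auto
    finally show ?thesis by (rule bigo_power_cancel)
  qed
  have P_nz: "P \<noteq> 0" using P0 by auto
  \<comment> \<open>As \<open>P\<close> and \<open>Q * Y\<close> eventually have no common strict
    sign, \<open>P - Q * Y\<close> is at least as large as \<open>P\<close> in absolute value. Its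
    reciprocal \<open>P + Q * Y\<close> is thus of order at most \<open>s^(-n)\<close>.\<close>
  have small: "(\<lambda>s. (poly P s + poly Q s * Y s) * s ^ n) \<in> O(\<lambda>_. 1)"
  proof -
    have "(\<lambda>s. (poly P s + poly Q s * Y s) * s ^ n) \<in> O(\<lambda>s. (poly P s + poly Q s * Y s) * poly P s)"
      using bigthetaD2 [OF poly_bigtheta [OF P_nz]] P
      by (intro landau_o.big.mult) (auto simp: bigomega_iff_bigo)
    also have "(\<lambda>s. (poly P s + poly Q s * Y s) * poly P s) \<in> O(\<lambda>_. 1)"
    proof (rule bigoI [of _ 1])
      show "\<forall>\<^sub>F s in at_top. norm ((poly P s + poly Q s * Y s) * poly P s) \<le> 1 * norm (1::real)"
        using big sign
      proof eventually_elim
        case (elim s)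
        define p where "p = poly P s"
        define q where "q = poly Q s * Y s"
        have pq: "(p + q) * (p - q) = 1"
        proof -
          have "q\<^sup>2 = R s * (poly Q s)\<^sup>2" using elim by (simp add: q_def power_mult_distrib)
          then have "p\<^sup>2 - q\<^sup>2 = 1" using PQ' [of s] by (simp add: p_def)
          then show ?thesis by (simp add: power2_eq_square algebra_simps)
        qed
        have "p * q \<le> 0"
          using elim mult_right_mono [of "poly P s * poly Q s" 0 "Y s"] unfolding p_def q_def by (simp add: mult_ac)
        then have "\<bar>p\<bar> \<le> \<bar>p - q\<bar>"
          by (auto simp: mult_le_0_iff abs_if)
        then have "\<bar>p + q\<bar> * \<bar>p\<bar> \<le> \<bar>p + q\<bar> * \<bar>p - q\<bar>" by (intro mult_left_mono) auto
        also have "\<dots> = 1" using pq by (metis abs_mult abs_one)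
        finally show ?case by (simp add: abs_mult p_def q_def)
      qed
    qed
    finally show ?thesis .
  qed
  define N11 where "N11 = P + Q * l11 0"
  define N12 where "N12 = Q * l12 0"
  define N21 where "N21 = Q * l21 0"
  define N22 where "N22 = P - Q * l11 0"
  have degQ: "Q = 0 \<or> degree Q + 2 \<le> n"
  proof (cases "Q = 0")
    case False
    have "cubic A B * [:-g, 1:] * Q\<^sup>2 = P\<^sup>2 - 1" using PQ by (simp add: algebra_simps)
    moreover have "degree (cubic A B * [:-g, 1:] * Q\<^sup>2) = 4 + 2 * degree Q"
      using False by (simp add: degree_mult_eq degree_power_eq degree_cubic cubic_nonzero del: mult_pCons_right)
    moreover have "degree (P\<^sup>2 - 1) \<le> 2 * n"
      using P by (intro degree_diff_le) (auto simp: degree_power_eq P_nz)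
    ultimately show ?thesis by auto
  qed simp
  have Ql: "degree (Q * l) \<le> n" if "degree l \<le> 2" for l
    using degQ that degree_mult_le [of Q l] by auto
  have degN: "degree N11 \<le> n" "degree N12 \<le> n" "degree N21 \<le> n" "degree N22 \<le> n"
  proof -
    have "degree (l11 0) \<le> 2" "degree (l12 0) \<le> 2" "degree (l21 0) \<le> 2"
      by (simp_all add: l11_def l12_def l21_def)
    then have "degree (Q * l11 0) \<le> n" "degree (Q * l12 0) \<le> n" "degree (Q * l21 0) \<le> n"
      by (simp_all only: Ql)
    then show "degree N11 \<le> n" "degree N12 \<le> n" "degree N21 \<le> n" "degree N22 \<le> n"
      unfolding N11_def N12_def N21_def N22_def
      using P by (auto intro!: degree_add_le degree_diff_le)
  qed
  have degM: "degree (M11 n) \<le> n" "degree (M12 n) \<le> n" "degree (M21 n) \<le> n" "degree (M22 n) \<le> n"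
    using degree_M [of n] by auto
  have M1: "(\<lambda>s. (poly (M11 n) s * e1 s + poly (M12 n) s * e2 s) * s ^ n) \<in> O(\<lambda>s. s\<^sup>2)"
    using Z1 [of n] by (simp add: Z1_def pos_def)
  have M2: "(\<lambda>s. (poly (M21 n) s * e1 s + poly (M22 n) s * e2 s) * s ^ n) \<in> O(\<lambda>s. s\<^sup>2)"
    using Z2 [of n] by (simp add: Z2_def vel_def)
  have N: "(\<lambda>s. (poly P s + poly Q s * Y s) * s ^ n * e s) \<in> O(\<lambda>s. s\<^sup>2)" if "e \<in> O(\<lambda>s. s\<^sup>2)" for e
    using landau_o.big.mult [OF small that] by simp
  have N1: "(\<lambda>s. (poly N11 s * e1 s + poly N12 s * e2 s) * s ^ n) \<in> O(\<lambda>s. s\<^sup>2)"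
    and N2: "(\<lambda>s. (poly N21 s * e1 s + poly N22 s * e2 s) * s ^ n) \<in> O(\<lambda>s. s\<^sup>2)"
  proof -
    have eq1: "\<forall>\<^sub>F s in at_top. (poly N11 s * e1 s + poly N12 s * e2 s) * s ^ n = (poly P s + poly Q s * Y s) * s ^ n * e1 s"
      using big
    proof eventually_elim
      case (elim s)
      then have "(Y s)\<^sup>2 = R s" by simp
      then have "poly N11 s * e1 s + poly N12 s * e2 s = (poly P s + poly Q s * Y s) * e1 s"
        using L_square [of 0 s]
        unfolding N11_def N12_def e1_def e2_def R_def poly_add poly_mult poly_l by algebra
      then show ?case by (simp add: mult_ac)
    qed
    have eq2: "(poly N21 s * e1 s + poly N22 s * e2 s) * s ^ n = (poly P s + poly Q s * Y s) * s ^ n * e2 s" for s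
    proof -
      have "poly N21 s * e1 s + poly N22 s * e2 s = (poly P s + poly Q s * Y s) * e2 s"
        unfolding N21_def N22_def e1_def e2_def poly_diff poly_mult poly_l by algebra
      then show ?thesis by (simp add: mult_ac)
    qed
    show "(\<lambda>s. (poly N11 s * e1 s + poly N12 s * e2 s) * s ^ n) \<in> O(\<lambda>s. s\<^sup>2)"
      unfolding landau_o.big.in_cong [OF eq1] by (rule N [OF e1])
    show "(\<lambda>s. (poly N21 s * e1 s + poly N22 s * e2 s) * s ^ n) \<in> O(\<lambda>s. s\<^sup>2)"
      unfolding eq2 by (rule N [OF e2])
  qed
  have den0: "(\<lambda>s. s\<^sup>2) \<in> O(e1)" using den [of 0] by (simp add: e1_def [abs_def])
  \<comment> \<open>The upper right entries are not normalized at 0, so \<open>N\<close> is only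
    known to be \<open>((1, c), (0, 1)) M\<close> with some constant \<open>c\<close>.\<close>
  define c where "c = poly (N12 * M11 n - N11 * M12 n) 0"
  have K: "poly N11 s * poly (M22 n) s - poly N12 s * poly (M21 n) s = 1"
    "poly N12 s * poly (M11 n) s - poly N11 s * poly (M12 n) s = c"
    "poly N21 s * poly (M22 n) s - poly N22 s * poly (M21 n) s = 0"
    "poly N22 s * poly (M11 n) s - poly N21 s * poly (M12 n) s = 1" for s
  proof -
    have at0: "poly N11 0 = 1" "poly N21 0 = 0" "poly N22 0 = 1"
      unfolding N11_def N21_def N22_def by (simp_all add: P0 poly_l L11_def L21_def)
    show "poly N11 s * poly (M22 n) s - poly N12 s * poly (M21 n) s = 1"
      using row_det_const [OF degN(1,2) degM(3,4) N1 M2 den0, of s] by (simp add: at0 M_at_0)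
    show "poly N12 s * poly (M11 n) s - poly N11 s * poly (M12 n) s = c"
      using row_det_const [OF degN(1,2) degM(1,2) N1 M1 den0, of s] by (simp add: c_def)
    show "poly N21 s * poly (M22 n) s - poly N22 s * poly (M21 n) s = 0"
      using row_det_const [OF degN(3,4) degM(3,4) N2 M2 den0, of s] by (simp add: at0 M_at_0)
    show "poly N22 s * poly (M11 n) s - poly N21 s * poly (M12 n) s = 1"
      using row_det_const [OF degN(3,4) degM(1,2) N2 M1 den0, of s] by (simp add: at0 M_at_0)
  qed
  \<comment> \<open>On a kernel vector of \<open>L\<close> where \<open>P = 1\<close> the matrix
    \<open>N\<close> is the identity, so \<open>M\<close> can change the position only by a multiple
    of the velocity.\<close>
  have recover: "p = pos n s p q + c * vel n s p q" "q = vel n s p q"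
    if "poly P s = 1" "L11 0 s * p + L12 0 s * q = 0" "L21 0 s * p - L11 0 s * q = 0" for s p q
  proof -
    have Np: "poly N11 s * p + poly N12 s * q = p" and Nq: "poly N21 s * p + poly N22 s * q = q"
      using that unfolding N11_def N12_def N21_def N22_def poly_add poly_diff poly_mult poly_l by algebra+
    have "poly N11 s = poly (M11 n) s + c * poly (M21 n) s" "poly N12 s = poly (M12 n) s + c * poly (M22 n) s"
      using K(1,2) [of s] M_det [of n s] by algebra+
    then show "p = pos n s p q + c * vel n s p q"
      using Np by (simp add: pos_def vel_def algebra_simps)
    have "poly N21 s = poly (M21 n) s" "poly N22 s = poly (M22 n) s"
      using K(3,4) [of s] M_det [of n s] by algebra+
    then show "q = vel n s p q"
      using Nq by (simp add: vel_def)
  qed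
  have xn: "x 0 = x n + c * u n" "u 0 = u n"
    using recover [OF P0(2) L_kernel(1,2)] orbit_pos_vel(1,2) [of n] by auto
  have yn: "y 0 = y n + c * w n" "w 0 = w n"
    using recover [OF P0(3) L_kernel(3,4)] orbit_pos_vel(3,4) [of n] by auto
  \<comment> \<open>Positions 0 and \<open>n\<close> lie on one line with the same velocity; both
    satisfying \<open>inward\<close> leaves no room for a shift along it.\<close>
  have "c * be n = 0"
    using inward [of 0] inward [of n] xn yn unfolding be_def by algebra
  then have "c = 0" using be_nonzero by simp
  then show ?thesis using xn yn by simp
qed

text \<open>Replacing \<open>Q\<close> by \<open>- Q\<close> preserves the Pell conditions, so the
  sign condition can always be arranged.\<close>

lemma pell_solvable_imp_periodic:
  assumes "pell_solvable A B g n"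
  shows "x n = x 0 \<and> y n = y 0"
proof -
  obtain P Q where PQ: "degree P = n" "P\<^sup>2 - cubic A B * [:-g, 1:] * Q\<^sup>2 = 1"
    "poly P 0 = 1" "poly P A = 1" "poly P (-B) = 1"
    using assms unfolding pell_solvable_def by auto
  consider "\<forall>\<^sub>F s in at_top. poly (P * Q) s \<ge> 0" | "\<forall>\<^sub>F s in at_top. poly (P * Q) s \<le> 0"
    using eventually_poly_sign by blast
  then show ?thesis
  proof cases
    case 1
    then show ?thesis
      using pell_solution_imp_periodic [of P n "- Q"] PQ by simp
  next
    case 2
    then show ?thesis
      using pell_solution_imp_periodic [of P n Q] PQ by simp
  qed
qed

end

section \<open>Trajectories as normalized orbits\<close>

text \<open>By the Gram identity this says that the quadratic form of the conic, restricted to the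
  line, has a double zero. The cross product of \<open>P\<close> and \<open>v\<close> does not
  depend on the point chosen on the line, and an asymptote is the case
  \<open>Q v v = 0\<close>.\<close>

lemma line_tangent_iff:
  assumes "C \<noteq> 0" "D \<noteq> 0" and v: "v \<noteq> 0"
  shows "line_tangent C D P v \<longleftrightarrow>
    (fst P * snd v - snd P * fst v)\<^sup>2 = C * (snd v)\<^sup>2 + D * (fst v)\<^sup>2"
proof -
  define Q where "Q X Z = conic_form C D X Z" for X Z
  define c where "c = 1 / C"
  define d where "d = 1 / D"
  have cd: "C * c = 1" "D * d = 1" using assms by (simp_all add: c_def d_def)
  have Q: "Q X Z = c * (fst X * fst Z) + d * (snd X * snd Z)" for X Z
    by (simp add: Q_def conic_form_def c_def d_def)
  have Gram: "(fst X * snd v - snd X * fst v)\<^sup>2 = C * D * (Q X X * Q v v - (Q X v)\<^sup>2)" for X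
    unfolding Q using cd by algebra
  have rhs: "C * (snd v)\<^sup>2 + D * (fst v)\<^sup>2 = C * D * Q v v"
    unfolding Q using cd by algebra
  have conic: "X \<in> conic C D \<longleftrightarrow> Q X X = 1" for X
    unfolding Q_def conic_form_def conic_def by (simp add: power2_eq_square)
  have lin: "Q (P + t *\<^sub>R v) v = Q P v + t * Q v v" for t
    unfolding Q by (simp add: algebra_simps)
  have tan: "line_tangent C D P v \<longleftrightarrow>
      (\<exists>t. Q (P + t *\<^sub>R v) (P + t *\<^sub>R v) = 1 \<and> Q (P + t *\<^sub>R v) v = 0) \<or> Q v v = 0 \<and> Q P v = 0"
    unfolding line_tangent_def conic tangent_direction_def using v by (simp add: Q_def)
  have shift: "fst (P + t *\<^sub>R v) * snd v - snd (P + t *\<^sub>R v) * fst v = fst P * snd v - snd P * fst v" for t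
    by (simp add: algebra_simps)
  show ?thesis
    unfolding tan rhs
  proof
    assume "(\<exists>t. Q (P + t *\<^sub>R v) (P + t *\<^sub>R v) = 1 \<and> Q (P + t *\<^sub>R v) v = 0) \<or> Q v v = 0 \<and> Q P v = 0"
    then show "(fst P * snd v - snd P * fst v)\<^sup>2 = C * D * Q v v"
    proof (elim disjE exE conjE)
      fix t assume "Q (P + t *\<^sub>R v) (P + t *\<^sub>R v) = 1" "Q (P + t *\<^sub>R v) v = 0"
      then show ?thesis using Gram [of "P + t *\<^sub>R v"] unfolding shift by simp
    next
      assume "Q v v = 0" "Q P v = 0"
      then show ?thesis using Gram [of P] by simp
    qed
  next
    assume *: "(fst P * snd v - snd P * fst v)\<^sup>2 = C * D * Q v v"
    show "(\<exists>t. Q (P + t *\<^sub>R v) (P + t *\<^sub>R v) = 1 \<and> Q (P + t *\<^sub>R v) v = 0) \<or> Q v v = 0 \<and> Q P v = 0"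
    proof (cases "Q v v = 0")
      case True
      then show ?thesis using * Gram [of P] assms by simp
    next
      case False
      define t where "t = - Q P v / Q v v"
      have 0: "Q (P + t *\<^sub>R v) v = 0" unfolding lin t_def using False by simp
      have "C * D * (Q (P + t *\<^sub>R v) (P + t *\<^sub>R v) * Q v v) = C * D * Q v v"
        using Gram [of "P + t *\<^sub>R v"] * unfolding shift 0 by simp
      then have "Q (P + t *\<^sub>R v) (P + t *\<^sub>R v) = 1" using assms False by simp
      then show ?thesis using 0 by blast
    qed
  qed
qed

text \<open>Here \<open>D\<close> and \<open>E\<close> are the incoming and outgoing chords at
  \<open>q\<close>, and \<open>S\<close>, \<open>S'\<close> their squared lengths in the metric of
  the ellipse. With the scaling \<open>2 / S\<close>, reflection adds exactly
  \<open>2 / \<kappa>\<close> times the Minkowski normal.\<close>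

lemma reflection_step:
  fixes A B q1 q2 d1 d2 D1 D2 E1 E2 u1 u2 w1 w2 c k :: real
  assumes q: "A * q1\<^sup>2 + B * q2\<^sup>2 = 1"
    and d: "A * q1 * d1 + B * q2 * d2 = 0" "d1\<^sup>2 - d2\<^sup>2 \<noteq> 0"
    and S: "S > 0" "A * q1 * D1 + B * q2 * D2 = S / 2"
    and S': "S' > 0" "A * q1 * E1 + B * q2 * E2 = - S' / 2"
    and D: "D1 = u1 + w1" "D2 = u2 + w2" and u: "u1 = c * d1" "u2 = c * d2"
    and w: "w1 * d1 - w2 * d2 = 0" and E: "k * E1 = u1 - w1" "k * E2 = u2 - w2"
  defines "\<kappa> \<equiv> B\<^sup>2 * q2\<^sup>2 - A\<^sup>2 * q1\<^sup>2"
  shows "\<kappa> \<noteq> 0" "2 / S' * E1 = 2 / S * D1 + 2 / \<kappa> * (A * q1)" "2 / S' * E2 = 2 / S * D2 - 2 / \<kappa> * (B * q2)"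
proof -
  define r where "r = A\<^sup>2 * q1\<^sup>2 + B\<^sup>2 * q2\<^sup>2"
  have "A * q1 \<noteq> 0 \<or> B * q2 \<noteq> 0"
    using q by (auto simp: power2_eq_square)
  then have r: "r \<noteq> 0" unfolding r_def
    by (metis power_mult_distrib sum_power2_eq_zero_iff)
  \<comment> \<open>The tangent direction \<open>d\<close> is \<open>t\<close> times
    \<open>(- B * q2, A * q1)\<close>; below, the orthogonal part \<open>w\<close> is
    \<open>\<tau>\<close> times the Minkowski normal.\<close>
  define t where "t = (A * q1 * d2 - B * q2 * d1) / r"
  have rt: "r * t = A * q1 * d2 - B * q2 * d1" using r by (simp add: t_def)
  have "r * d1 = r * (t * (- B * q2))" "r * d2 = r * (t * (A * q1))"
    using rt d(1) unfolding r_def by algebra+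
  then have dt: "d1 = t * (- B * q2)" "d2 = t * (A * q1)" using r by (metis mult_left_cancel)+
  have "d1\<^sup>2 - d2\<^sup>2 = t\<^sup>2 * \<kappa>" unfolding dt \<kappa>_def by algebra
  then have kap: "\<kappa> \<noteq> 0" and t: "t \<noteq> 0" using d(2) by auto
  then show "\<kappa> \<noteq> 0" by simp
  have wo: "w1 * B * q2 + w2 * A * q1 = 0" using w dt t by algebra
  define \<tau> where "\<tau> = (w1 * A * q1 - w2 * B * q2) / r"
  have rtau: "r * \<tau> = w1 * A * q1 - w2 * B * q2" using r by (simp add: \<tau>_def)
  have "r * w1 = r * (\<tau> * A * q1)" "r * w2 = r * (- \<tau> * B * q2)"
    using rtau wo unfolding r_def by algebra+
  then have wt: "w1 = \<tau> * A * q1" "w2 = - \<tau> * B * q2" using r by (metis mult_left_cancel)+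
  have u0: "A * q1 * u1 + B * q2 * u2 = 0" using u d(1) by algebra
  \<comment> \<open>Pairing the chords with the gradient of the ellipse annihilates the tangential
    part. The incoming chord gives \<open>\<tau>\<close>, the outgoing one the scale
    \<open>k\<close>.\<close>
  have tau: "S = - 2 * \<tau> * \<kappa>" using S(2) D u0 wt unfolding \<kappa>_def by algebra
  have "k * (A * q1 * E1 + B * q2 * E2) = \<tau> * \<kappa>"
    using E u0 wt unfolding \<kappa>_def by algebra
  then have kS: "k * S' = S" using S'(2) tau by simp
  then have k: "k \<noteq> 0" using S by auto
  have kE: "k * E1 = D1 - 2 * \<tau> * A * q1" "k * E2 = D2 + 2 * \<tau> * B * q2"
    using E D wt by algebra+
  have S'k: "2 / S' * X = 2 / S * (k * X)" for X
    using S'(1) k by (simp add: kS [symmetric])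
  have tS: "\<tau> / S = - 1 / (2 * \<kappa>)" using kap S(1) tau by (subst frac_eq_eq) auto
  have "2 / S' * E1 = 2 / S * D1 - 4 * (\<tau> / S) * (A * q1)" unfolding S'k kE by (simp add: algebra_simps)
  also have "\<dots> = 2 / S * D1 + 2 / \<kappa> * (A * q1)" unfolding tS by simp
  finally show "2 / S' * E1 = 2 / S * D1 + 2 / \<kappa> * (A * q1)" .
  have "2 / S' * E2 = 2 / S * D2 + 4 * (\<tau> / S) * (B * q2)" unfolding S'k kE by (simp add: algebra_simps)
  also have "\<dots> = 2 / S * D2 - 2 / \<kappa> * (B * q2)" unfolding tS by simp
  finally show "2 / S' * E2 = 2 / S * D2 - 2 / \<kappa> * (B * q2)" .
qed

locale ellipse_caustic =
  fixes a b \<gamma> :: real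
  assumes a_pos: "a > 0" and b_pos: "b > 0" and caustic_param: "\<gamma> \<notin> {-b, 0, a}"
begin

lemma reciprocal_param: "1 / \<gamma> \<noteq> 0" "1 / \<gamma> \<noteq> 1 / a" "1 / \<gamma> \<noteq> - (1 / b)"
proof -
  show "1 / \<gamma> \<noteq> 0" using caustic_param by simp
  show "1 / \<gamma> \<noteq> 1 / a"
  proof
    assume "1 / \<gamma> = 1 / a"
    then have "\<gamma> = a" by (metis inverse_eq_divide inverse_inverse_eq)
    then show False using caustic_param by simp
  qed
  show "1 / \<gamma> \<noteq> - (1 / b)"
  proof
    assume "1 / \<gamma> = - (1 / b)"
    then have "\<gamma> = - b" by (metis inverse_eq_divide inverse_inverse_eq inverse_minus_eq)
    then show False using caustic_param by simp
  qed
qed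

text \<open>Both ends of a chord lie on the ellipse, so its pairing with the gradient is
  \<open>- S k / 2\<close> at the start and \<open>S k / 2\<close> at the end. Dividing the chord by
  \<open>S k / 2\<close> gives the velocity required by \<open>inward\<close>.\<close>

lemma trajectory_imp_orbit:
  assumes traj: "billiard_trajectory a b X" and caus: "has_caustic a b \<gamma> X"
  shows "\<exists>u w mu nu. normalized_orbit (1 / a) (1 / b) (1 / \<gamma>) (\<lambda>k. fst (X k)) (\<lambda>k. snd (X k)) u w mu nu"
proof -
  define x where "x k = fst (X k)" for k
  define y where "y k = snd (X k)" for k
  define A where "A = 1 / a"
  define B where "B = 1 / b"
  define g where "g = 1 / \<gamma>"
  have AB: "A > 0" "B > 0" using a_pos b_pos by (simp_all add: A_def B_def)
  have inv: "a * A = 1" "b * B = 1" "\<gamma> * g = 1"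
    using a_pos b_pos caustic_param by (simp_all add: A_def B_def g_def)
  have clear: "X = a * b * (A * B * X)" for X
  proof -
    have "a * b * (A * B * X) = (a * A) * (b * B) * X" by (simp only: mult_ac)
    then show ?thesis unfolding inv by simp
  qed
  have g: "g \<noteq> 0" "g \<noteq> A" "g \<noteq> - B"
    using reciprocal_param by (simp_all add: g_def A_def B_def)
  define D1 where "D1 k = x (Suc k) - x k" for k
  define D2 where "D2 k = y (Suc k) - y k" for k
  define S where "S k = A * (D1 k)\<^sup>2 + B * (D2 k)\<^sup>2" for k
  define \<kappa> where "\<kappa> k = B\<^sup>2 * (y k)\<^sup>2 - A\<^sup>2 * (x k)\<^sup>2" for k
  have ell: "A * (x k)\<^sup>2 + B * (y k)\<^sup>2 = 1" for k
    using traj unfolding billiard_trajectory_def conic_def x_def y_def A_def B_def by simp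
  have Dnz: "D1 k \<noteq> 0 \<or> D2 k \<noteq> 0" for k
  proof -
    have "X (k + 1) \<noteq> X k" using traj unfolding billiard_trajectory_def by blast
    then show ?thesis by (auto simp: D1_def D2_def x_def y_def prod_eq_iff)
  qed
  have S: "S k > 0" for k
  proof -
    have "A * (D1 k)\<^sup>2 \<ge> 0" "B * (D2 k)\<^sup>2 \<ge> 0" using AB by simp_all
    moreover have "A * (D1 k)\<^sup>2 \<noteq> 0 \<or> B * (D2 k)\<^sup>2 \<noteq> 0" using Dnz [of k] AB by simp
    ultimately show ?thesis unfolding S_def by linarith
  qed
  have in0: "A * x k * D1 k + B * y k * D2 k = - S k / 2" for k
    using ell [of k] ell [of "Suc k"] unfolding S_def D1_def D2_def by algebra
  have in1: "A * x (Suc k) * D1 k + B * y (Suc k) * D2 k = S k / 2" for k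
    using ell [of k] ell [of "Suc k"] unfolding S_def D1_def D2_def by algebra
  have step: "\<kappa> (Suc k) \<noteq> 0 \<and>
      2 / S (Suc k) * D1 (Suc k) = 2 / S k * D1 k + 2 / \<kappa> (Suc k) * (A * x (Suc k)) \<and>
      2 / S (Suc k) * D2 (Suc k) = 2 / S k * D2 k - 2 / \<kappa> (Suc k) * (B * y (Suc k))" for k
  proof -
    obtain d e where d: "tangent_direction a b (X (Suc k)) d" "\<not> light_like d"
      and refl: "mink_reflection d (X (Suc k) - X k) (e *\<^sub>R (X (Suc (Suc k)) - X (Suc k)))"
      using traj unfolding billiard_trajectory_def by (metis Suc_eq_plus1 add_2_eq_Suc')
    obtain p r c where pr: "X (Suc k) - X k = p + r" "p = c *\<^sub>R d" "mink_orthogonal r d"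
      "e *\<^sub>R (X (Suc (Suc k)) - X (Suc k)) = p - r"
      using refl unfolding mink_reflection_def by blast
    have "A * x (Suc k) * fst d + B * y (Suc k) * snd d = 0" "(fst d)\<^sup>2 - (snd d)\<^sup>2 \<noteq> 0"
      using d unfolding tangent_direction_def conic_form_def light_like_def mink_def A_def B_def x_def y_def
      by (simp_all add: power2_eq_square)
    moreover have "D1 k = fst p + fst r" "D2 k = snd p + snd r" "fst p = c * fst d" "snd p = c * snd d"
      "fst r * fst d - snd r * snd d = 0"
      "e * D1 (Suc k) = fst p - fst r" "e * D2 (Suc k) = snd p - snd r"
      using arg_cong [OF pr(1), of fst] arg_cong [OF pr(1), of snd] pr(2,3)
        arg_cong [OF pr(4), of fst] arg_cong [OF pr(4), of snd]
      by (simp_all add: D1_def D2_def x_def y_def mink_orthogonal_def mink_def)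
    ultimately show ?thesis
      using reflection_step [OF ell [of "Suc k"] _ _ S in1 S in0] unfolding \<kappa>_def by metis
  qed
  \<comment> \<open>The tangency criterion is combined with Lagrange's identity for position and
    chord, and the reciprocals are cleared.\<close>
  have caus': "4 * A * B * ((D1 k)\<^sup>2 - (D2 k)\<^sup>2) = - g * (S k)\<^sup>2" for k
  proof -
    have "X (Suc k) - X k \<noteq> 0" using Dnz [of k] by (auto simp: D1_def D2_def x_def y_def)
    then have "(x k * D2 k - y k * D1 k)\<^sup>2 = (a - \<gamma>) * (D2 k)\<^sup>2 + (b + \<gamma>) * (D1 k)\<^sup>2"
      using caus line_tangent_iff [of "a - \<gamma>" "b + \<gamma>" "X (Suc k) - X k" "X k"] caustic_param
      unfolding has_caustic_def by (simp add: D1_def D2_def x_def y_def)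
    moreover have "4 * (x k * D2 k - y k * D1 k)\<^sup>2 = a * b * (4 * S k - (S k)\<^sup>2)"
    proof -
      have "A * B * (x k * D2 k - y k * D1 k)\<^sup>2 = S k - (A * x k * D1 k + B * y k * D2 k)\<^sup>2"
        using ell [of k] unfolding S_def by algebra
      then have "A * B * (4 * (x k * D2 k - y k * D1 k)\<^sup>2) = 4 * S k - (S k)\<^sup>2"
        unfolding in0 by (simp add: power_divide)
      then show ?thesis using clear [of "4 * (x k * D2 k - y k * D1 k)\<^sup>2"] by simp
    qed
    moreover have "a * b * S k = a * (D2 k)\<^sup>2 + b * (D1 k)\<^sup>2"
    proof -
      have "a * b * S k = (a * A) * (b * (D1 k)\<^sup>2) + (b * B) * (a * (D2 k)\<^sup>2)"
        unfolding S_def by algebra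
      then show ?thesis unfolding inv by simp
    qed
    ultimately have *: "4 * \<gamma> * ((D2 k)\<^sup>2 - (D1 k)\<^sup>2) = a * b * (S k)\<^sup>2"
      by (simp add: algebra_simps)
    have "4 * A * B * ((D1 k)\<^sup>2 - (D2 k)\<^sup>2) = (\<gamma> * g) * (4 * A * B * ((D1 k)\<^sup>2 - (D2 k)\<^sup>2))"
      unfolding inv by simp
    also have "\<dots> = - g * (A * B * (4 * \<gamma> * ((D2 k)\<^sup>2 - (D1 k)\<^sup>2)))"
      by (simp add: algebra_simps)
    also have "\<dots> = - g * (a * b * (A * B * (S k)\<^sup>2))"
      unfolding * by (simp only: mult_ac)
    finally show ?thesis unfolding clear [symmetric] .
  qed
  define r where "r k = 2 / S k" for k
  have rS: "r k * S k = 2" for k using S [of k] by (simp add: r_def)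
  have "normalized_orbit A B g x y (\<lambda>k. r k * D1 k) (\<lambda>k. r k * D2 k) (\<lambda>k. S k / 2) (\<lambda>k. 2 / \<kappa> (Suc k))"
  proof
    fix k
    have "2 * (A * x k * D1 k + B * y k * D2 k) = - S k" unfolding in0 by simp
    then have "2 * (A * x k * (r k * D1 k) + B * y k * (r k * D2 k)) = 2 * (- 1)"
      using rS [of k] by algebra
    then show "A * x k * (r k * D1 k) + B * y k * (r k * D2 k) = - 1" by simp
    have "4 * (A * B * ((r k * D1 k)\<^sup>2 - (r k * D2 k)\<^sup>2)) = 4 * (- g)"
      using caus' [of k] rS [of k] by algebra
    then show "A * B * ((r k * D1 k)\<^sup>2 - (r k * D2 k)\<^sup>2) = - g" by simp
    have "S k * (A * (r k * D1 k)\<^sup>2 + B * (r k * D2 k)\<^sup>2) = (r k * S k)\<^sup>2"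
      unfolding S_def by algebra
    then show "S k / 2 * (A * (r k * D1 k)\<^sup>2 + B * (r k * D2 k)\<^sup>2) = 2"
      unfolding rS by simp
    have "2 / \<kappa> (Suc k) * \<kappa> (Suc k) = 2" using step [of k] by simp
    then show "2 / \<kappa> (Suc k) * (B\<^sup>2 * (y (Suc k))\<^sup>2 - A\<^sup>2 * (x (Suc k))\<^sup>2) = 2"
      unfolding \<kappa>_def [of "Suc k"] .
    have half: "S k / 2 * (r k * z) = z" for z
      using S [of k] by (simp add: r_def)
    show "x (Suc k) = x k + S k / 2 * (r k * D1 k)" "y (Suc k) = y k + S k / 2 * (r k * D2 k)"
      unfolding half by (simp_all add: D1_def D2_def)
    show "r (Suc k) * D1 (Suc k) = r k * D1 k + 2 / \<kappa> (Suc k) * A * x (Suc k)"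
      "r (Suc k) * D2 (Suc k) = r k * D2 k - 2 / \<kappa> (Suc k) * B * y (Suc k)"
      using step [of k] by (simp_all only: r_def mult.assoc)
  qed (use AB g ell in auto)
  then show ?thesis unfolding x_def y_def A_def B_def g_def by blast
qed

lemma orbit_imp_trajectory:
  assumes "normalized_orbit (1 / a) (1 / b) (1 / \<gamma>) x y u w mu nu"
  defines "X \<equiv> (\<lambda>k. (x k, y k))"
  shows "billiard_trajectory a b X" "has_caustic a b \<gamma> X"
proof -
  define A where "A = 1 / a"
  define B where "B = 1 / b"
  define g where "g = 1 / \<gamma>"
  interpret normalized_orbit A B g x y u w mu nu
    using assms(1) unfolding A_def B_def g_def .
  have inv: "a * A = 1" "b * B = 1" "\<gamma> * g = 1"
    using a_pos b_pos caustic_param by (simp_all add: A_def B_def g_def)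
  have clear: "X = a * b * (A * B * X)" for X
  proof -
    have "a * b * (A * B * X) = (a * A) * (b * B) * X" by (simp only: mult_ac)
    then show ?thesis unfolding inv by simp
  qed
  have be_pos: "be k > 0" for k
  proof -
    have "be k \<ge> 0" unfolding be_def using A_pos B_pos by simp
    then show ?thesis using be_nonzero [of k] by simp
  qed
  have mu_pos: "mu k > 0" for k
    using mu_be [of k] be_pos [of k] by (metis zero_less_mult_pos2 zero_less_numeral)
  have uw: "u k \<noteq> 0 \<or> w k \<noteq> 0" for k
    using be_nonzero [of k] by (auto simp: be_def)
  have diff: "X (Suc k) - X k = (mu k * u k, mu k * w k)" for k
    by (simp add: X_def x_Suc y_Suc)
  have nz: "X (Suc k) - X k \<noteq> 0" for k
    unfolding diff using uw [of k] mu_nonzero [of k] by (auto simp: zero_prod_def)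
  show "billiard_trajectory a b X"
    unfolding billiard_trajectory_def
  proof (intro conjI allI)
    fix k
    show "X k \<in> conic a b"
      using on_ellipse [of k] by (simp add: conic_def X_def A_def B_def)
    show "X (k + 1) \<noteq> X k" using nz [of k] by auto
    define d where "d = (- B * y (Suc k), A * x (Suc k))"
    \<comment> \<open>Displacements are \<open>mu\<close> times velocities, so this factor makes the
      two chords comparable at the common vertex.\<close>
    define e where "e = mu k / mu (Suc k)"
    have "tangent_direction a b (X (k + 1)) d"
      using on_ellipse [of "Suc k"] A_pos B_pos
      by (auto simp: tangent_direction_def d_def zero_prod_def conic_form_def X_def A_def B_def)
    moreover have "\<not> light_like d"
      using ka_Suc_nonzero [of k] by (simp add: light_like_def mink_def d_def ka_def power2_eq_square mult_ac)
    moreover have "e > 0" using mu_pos by (simp add: e_def)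
    moreover have "mink_reflection d (X (k + 1) - X k) (e *\<^sub>R (X (k + 2) - X (k + 1)))"
    proof -
      \<comment> \<open>\<open>(r1, r2)\<close> is minus half the velocity kick times
        \<open>mu k\<close>: subtracting it twice from the displacement performs the
        reflection.\<close>
      define r1 where "r1 = - mu k * nu k / 2 * A * x (Suc k)"
      define r2 where "r2 = mu k * nu k / 2 * B * y (Suc k)"
      define p1 where "p1 = mu k * u k - r1"
      define p2 where "p2 = mu k * w k - r2"
      have "A * x (Suc k) * u k + B * y (Suc k) * w k = 1"
        using inward [of k] mu_be [of k] unfolding x_Suc y_Suc be_def by algebra
      then have p0: "A * x (Suc k) * p1 + B * y (Suc k) * p2 = 0"
        unfolding p1_def p2_def r1_def r2_def using nu_ka [of k] unfolding ka_def by algebra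
      define m where "m = (A * x (Suc k))\<^sup>2 + (B * y (Suc k))\<^sup>2"
      have m: "m \<noteq> 0"
        using on_ellipse [of "Suc k"] A_pos B_pos by (auto simp: m_def)
      define c where "c = (A * x (Suc k) * p2 - B * y (Suc k) * p1) / m"
      have mc: "m * c = A * x (Suc k) * p2 - B * y (Suc k) * p1" using m by (simp add: c_def)
      have "m * p1 = m * (c * (- B * y (Suc k)))" "m * p2 = m * (c * (A * x (Suc k)))"
        using mc p0 unfolding m_def by algebra+
      then have "p1 = c * (- B * y (Suc k))" "p2 = c * (A * x (Suc k))"
        using m by (metis mult_left_cancel)+
      then have pc: "(p1, p2) = c *\<^sub>R d" by (simp add: d_def)
      have "X (k + 1) - X k = (p1, p2) + (r1, r2)"
        by (simp add: diff p1_def p2_def)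
      moreover have "mink_orthogonal (r1, r2) d"
        by (simp add: mink_orthogonal_def mink_def d_def r1_def r2_def)
      moreover have "e *\<^sub>R (X (k + 2) - X (k + 1)) = (p1, p2) - (r1, r2)"
        using diff [of "Suc k"] mu_nonzero [of "Suc k"]
        by (simp add: e_def p1_def p2_def r1_def r2_def u_Suc w_Suc algebra_simps)
      ultimately show ?thesis using pc unfolding mink_reflection_def by blast
    qed
    ultimately show "\<exists>d k'. tangent_direction a b (X (k + 1)) d \<and> \<not> light_like d \<and> k' > 0 \<and>
            mink_reflection d (X (k + 1) - X k) (k' *\<^sub>R (X (k + 2) - X (k + 1)))"
      by blast
  qed
  show "has_caustic a b \<gamma> X"
    unfolding has_caustic_def
  proof
    fix k
    have "A * B * (x k * w k - y k * u k)\<^sup>2 = be k - 1"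
      unfolding be_def using on_ellipse [of k] inward [of k] by algebra
    then have 1: "(x k * w k - y k * u k)\<^sup>2 = a * b * be k - a * b"
      using clear [of "(x k * w k - y k * u k)\<^sup>2"] by (simp add: right_diff_distrib)
    have "a * b * be k = (a * A) * (b * (u k)\<^sup>2) + (b * B) * (a * (w k)\<^sup>2)"
      unfolding be_def by algebra
    then have 2: "a * b * be k = b * (u k)\<^sup>2 + a * (w k)\<^sup>2"
      unfolding inv by simp
    have "\<gamma> * ((u k)\<^sup>2 - (w k)\<^sup>2) = a * b * \<gamma> * (A * B * ((u k)\<^sup>2 - (w k)\<^sup>2))"
      by (subst clear) (simp only: mult_ac)
    then have "\<gamma> * ((u k)\<^sup>2 - (w k)\<^sup>2) = - a * b * (\<gamma> * g)"
      unfolding caustic by simp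
    then have 3: "\<gamma> * ((u k)\<^sup>2 - (w k)\<^sup>2) = - a * b" unfolding inv by simp
    have "(x k * w k - y k * u k)\<^sup>2 = (a - \<gamma>) * (w k)\<^sup>2 + (b + \<gamma>) * (u k)\<^sup>2"
      using 1 2 3 by algebra
    then have "(mu k)\<^sup>2 * (x k * w k - y k * u k)\<^sup>2 = (mu k)\<^sup>2 * ((a - \<gamma>) * (w k)\<^sup>2 + (b + \<gamma>) * (u k)\<^sup>2)"
      by simp
    then have "(x k * (mu k * w k) - y k * (mu k * u k))\<^sup>2 = (a - \<gamma>) * (mu k * w k)\<^sup>2 + (b + \<gamma>) * (mu k * u k)\<^sup>2"
      by algebra
    then show "line_tangent (a - \<gamma>) (b + \<gamma>) (X k) (X (k + 1) - X k)"
      using line_tangent_iff [of "a - \<gamma>" "b + \<gamma>" "X (Suc k) - X k" "X k"] caustic_param nz [of k]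
      by (simp add: diff) (simp add: X_def)
  qed
qed

end

section \<open>Existence of trajectories\<close>

type_synonym state = "real \<times> real \<times> real \<times> real"

definition step :: "real \<Rightarrow> real \<Rightarrow> state \<Rightarrow> state" where
  "step A B = (\<lambda>(x, y, u, w).
     let m = 2 / (A * u\<^sup>2 + B * w\<^sup>2); x' = x + m * u; y' = y + m * w;
         n = 2 / (B\<^sup>2 * y'\<^sup>2 - A\<^sup>2 * x'\<^sup>2)
     in (x', y', u + n * A * x', w - n * B * y'))"

text \<open>The kick depends only on the new position and the move only on the old velocity, so they
  can be undone in reverse order. This remains true when a denominator is 0, where both sides use
  the value 0.\<close>

lemma inj_step: "inj (step A B)"
proof (rule inj_on_inverseI)
  fix \<sigma>
  show "(\<lambda>(x', y', u', w').
     let n = 2 / (B\<^sup>2 * y'\<^sup>2 - A\<^sup>2 * x'\<^sup>2); u = u' - n * A * x'; w = w' + n * B * y';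
         m = 2 / (A * u\<^sup>2 + B * w\<^sup>2)
     in (x' - m * u, y' - m * w, u, w)) (step A B \<sigma>) = \<sigma>"
    by (cases \<sigma>) (simp add: step_def Let_def)
qed

definition states :: "real \<Rightarrow> real \<Rightarrow> real \<Rightarrow> state set" where
  "states A B g = {(x, y, u, w). A * x\<^sup>2 + B * y\<^sup>2 = 1 \<and> A * x * u + B * y * w = - 1 \<and>
     A * B * (u\<^sup>2 - w\<^sup>2) = - g}"

text \<open>At a point with light-like tangent \<^const>\<open>step\<close> divides by zero, so it leaves the velocity
  unchanged.\<close>

definition exits :: "real \<Rightarrow> real \<Rightarrow> real \<Rightarrow> state set" where
  "exits A B g = {(x, y, u, w). A * x\<^sup>2 + B * y\<^sup>2 = 1 \<and> A * x * u + B * y * w = 1 \<and>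
     A * B * (u\<^sup>2 - w\<^sup>2) = - g \<and> B\<^sup>2 * y\<^sup>2 - A\<^sup>2 * x\<^sup>2 = 0}"

text \<open>A light-like tangent means \<open>B * y = s * (A * x)\<close> with a sign
  \<open>s\<close>, which leaves four points. There the pairing fixes \<open>u + s * w\<close>, and
  then \<open>u^2 - w^2\<close> fixes \<open>u - s * w\<close>.\<close>

lemma finite_exits:
  assumes "A > 0" "B > 0"
  shows "finite (exits A B g)"
proof -
  define r where "r = sqrt (B / (A * (A + B)))"
  define f where "f = (\<lambda>(x, e). (x, e * A * x / B, (1 / (A * x) - g * x / B) / 2, e * (1 / (A * x) + g * x / B) / 2))"
  have "exits A B g \<subseteq> f ` ({r, - r} \<times> {1, - 1})"
  proof
    fix \<sigma> assume "\<sigma> \<in> exits A B g"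
    then obtain x y u w where \<sigma>: "\<sigma> = (x, y, u, w)" and e: "A * x\<^sup>2 + B * y\<^sup>2 = 1"
      "A * x * u + B * y * w = 1" "A * B * (u\<^sup>2 - w\<^sup>2) = - g" "B\<^sup>2 * y\<^sup>2 - A\<^sup>2 * x\<^sup>2 = 0"
      unfolding exits_def by auto
    have "(B * y)\<^sup>2 = (A * x)\<^sup>2" using e(4) by (simp add: power_mult_distrib)
    then have "B * y = 1 * (A * x) \<or> B * y = - 1 * (A * x)" by (simp add: power2_eq_iff)
    then obtain s where s: "s \<in> {1, - 1}" "B * y = s * (A * x)" by blast
    have s2: "s * s = 1" using s(1) by auto
    have "A * (A + B) * x\<^sup>2 = B" using e(1,4) by algebra
    then have "x\<^sup>2 = B / (A * (A + B))" using assms by (simp add: eq_divide_eq mult.commute)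
    then have "x\<^sup>2 = r\<^sup>2" using assms by (simp add: r_def)
    then have x: "x \<in> {r, - r}" by (auto simp: power2_eq_iff)
    have "x \<noteq> 0" using e(1,4) assms by auto
    define p where "p = 1 / (A * x)"
    define q where "q = g * x / B"
    have p: "A * x * p = 1" and q: "B * q = g * x" using \<open>x \<noteq> 0\<close> assms by (simp_all add: p_def q_def)
    have "A * x * (u + s * w) = A * x * p" using e(2) s(2) p by algebra
    then have up: "u + s * w = p" using \<open>x \<noteq> 0\<close> assms by simp
    have "p * (u - s * w) = u\<^sup>2 - (s * s) * w\<^sup>2"
      unfolding up [symmetric] by (simp add: power2_eq_square algebra_simps)
    then have "p * (u - s * w) = u\<^sup>2 - w\<^sup>2" unfolding s2 by simp
    then have "A * B * p * (u - s * w) = - g" using e(3) by (simp add: mult.assoc)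
    also have "- g = A * B * p * (- q)" using p q by algebra
    finally have "(A * B * p) * (u - s * w) = (A * B * p) * (- q)" .
    moreover have "A * B * p \<noteq> 0" using p assms by auto
    ultimately have um: "u - s * w = - q" by (metis mult_left_cancel)
    have "u = (p - q) / 2" using up um by simp
    moreover have "s * w = (p + q) / 2" using up um by simp
    then have "w = s * (p + q) / 2" using s(1) by auto
    moreover have "y = s * A * x / B" using s(2) assms by (simp add: field_simps)
    ultimately have "\<sigma> = f (x, s)" unfolding f_def \<sigma> p_def q_def by simp
    then show "\<sigma> \<in> f ` ({r, - r} \<times> {1, - 1})" using x s(1) by blast
  qed
  then show ?thesis by (rule finite_subset) simp
qed

text \<open>The velocities allowed by the inward condition form the line
  \<open>(- x - t * B * y, - y + t * A * x)\<close>. On it the caustic condition is a quadratic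
  equation in \<open>t\<close> with leading coefficient \<open>\<kappa>\<close>.\<close>

lemma exists_state_at:
  assumes AB: "A > 0" "B > 0" and e: "A * x\<^sup>2 + B * y\<^sup>2 = 1"
    and k: "(B\<^sup>2 * y\<^sup>2 - A\<^sup>2 * x\<^sup>2) * g < 0"
  shows "\<exists>u w. (x, y, u, w) \<in> states A B g"
proof -
  define \<kappa> where "\<kappa> = B\<^sup>2 * y\<^sup>2 - A\<^sup>2 * x\<^sup>2"
  define h where "h = g / (A * B)"
  have h: "A * B * h = g" using AB by (simp add: h_def)
  have kap: "\<kappa> \<noteq> 0" using k unfolding \<kappa>_def by auto
  define D where "D = 1 - \<kappa> * h"
  have "\<kappa> * h < 0" using divide_neg_pos [OF k, of "A * B"] AB by (simp add: h_def \<kappa>_def)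
  then have "D \<ge> 0" by (simp add: D_def)
  \<comment> \<open>A root of this quadratic; \<open>D\<close> is its reduced discriminant, by the
    identity that uses the ellipse equation.\<close>
  define t where "t = (- x * y * (A + B) + sqrt D) / \<kappa>"
  have "(\<kappa> * t + x * y * (A + B))\<^sup>2 = D"
    using kap \<open>D \<ge> 0\<close> by (simp add: t_def)
  moreover have "(x * y * (A + B))\<^sup>2 - \<kappa> * (x\<^sup>2 - y\<^sup>2) = (A * x\<^sup>2 + B * y\<^sup>2)\<^sup>2"
    unfolding \<kappa>_def by algebra
  then have "(x * y * (A + B))\<^sup>2 - \<kappa> * (x\<^sup>2 - y\<^sup>2) = 1" unfolding e by simp
  ultimately have "\<kappa> * (\<kappa> * t\<^sup>2 + 2 * x * y * (A + B) * t + x\<^sup>2 - y\<^sup>2 + h) = 0"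
    unfolding D_def by algebra
  then have "\<kappa> * t\<^sup>2 + 2 * x * y * (A + B) * t + x\<^sup>2 - y\<^sup>2 + h = 0" using kap by simp
  moreover have "(- x - t * B * y)\<^sup>2 - (- y + t * A * x)\<^sup>2 = \<kappa> * t\<^sup>2 + 2 * x * y * (A + B) * t + x\<^sup>2 - y\<^sup>2"
    unfolding \<kappa>_def by algebra
  ultimately have "(- x - t * B * y)\<^sup>2 - (- y + t * A * x)\<^sup>2 = - h" by simp
  then have "A * B * ((- x - t * B * y)\<^sup>2 - (- y + t * A * x)\<^sup>2) = - g"
    using h by simp
  moreover have "A * x * (- x - t * B * y) + B * y * (- y + t * A * x) = - 1"
    using e by algebra
  ultimately show ?thesis using e unfolding states_def by blast
qed

text \<open>An arc of the ellipse on which \<open>exists_state_at\<close> applies is projected onto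
  an interval: an arc around the x-axis for \<open>g > 0\<close>, around the y-axis for
  \<open>g < 0\<close>.\<close>

lemma uncountable_states:
  assumes AB: "A > 0" "B > 0" and g: "g \<noteq> 0"
  shows "uncountable (states A B g)"
proof
  assume c: "countable (states A B g)"
  show False
  proof (cases "g > 0")
    case True
    \<comment> \<open>The positive second coordinate at which the tangent becomes light-like, the
      end of the arc.\<close>
    define r where "r = sqrt (A / (B * (A + B)))"
    have "{0<..<r} \<subseteq> (\<lambda>(x, y, u, w). y) ` states A B g"
    proof
      fix t assume "t \<in> {0<..<r}"
      then have "t\<^sup>2 < r\<^sup>2" by (intro power_strict_mono) auto
      then have "t\<^sup>2 < A / (B * (A + B))" using AB by (simp add: r_def)
      then have t: "B * (A + B) * t\<^sup>2 < A" using AB by (simp add: pos_less_divide_eq mult.commute)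
      have "B * B * t\<^sup>2 \<ge> 0" using AB by simp
      then have "A * (B * t\<^sup>2) < A * 1" using t by (simp add: algebra_simps)
      then have "B * t\<^sup>2 < 1" using AB by simp
      define x where "x = sqrt ((1 - B * t\<^sup>2) / A)"
      have x: "A * x\<^sup>2 + B * t\<^sup>2 = 1" using \<open>B * t\<^sup>2 < 1\<close> AB by (simp add: x_def)
      have "B\<^sup>2 * t\<^sup>2 - A\<^sup>2 * x\<^sup>2 = B * (A + B) * t\<^sup>2 - A" using x by algebra
      then have "(B\<^sup>2 * t\<^sup>2 - A\<^sup>2 * x\<^sup>2) * g < 0" using t True by (simp add: mult_neg_pos)
      from exists_state_at [OF AB x this] obtain u w where "(x, t, u, w) \<in> states A B g" by blast
      then show "t \<in> (\<lambda>(x, y, u, w). y) ` states A B g" by (rule rev_image_eqI) simp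
    qed
    moreover have "0 < r" using AB by (simp add: r_def)
    ultimately show False
      using c uncountable_open_interval [of 0 r] by (meson countable_image countable_subset)
  next
    case False
    define r where "r = sqrt (B / (A * (A + B)))"
    have "{0<..<r} \<subseteq> (\<lambda>(x, y, u, w). x) ` states A B g"
    proof
      fix t assume "t \<in> {0<..<r}"
      then have "t\<^sup>2 < r\<^sup>2" by (intro power_strict_mono) auto
      then have "t\<^sup>2 < B / (A * (A + B))" using AB by (simp add: r_def)
      then have t: "A * (A + B) * t\<^sup>2 < B" using AB by (simp add: pos_less_divide_eq mult.commute)
      have "A * A * t\<^sup>2 \<ge> 0" using AB by simp
      then have "B * (A * t\<^sup>2) < B * 1" using t by (simp add: algebra_simps)
      then have "A * t\<^sup>2 < 1" using AB by simp
      define y where "y = sqrt ((1 - A * t\<^sup>2) / B)"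
      have y: "A * t\<^sup>2 + B * y\<^sup>2 = 1" using \<open>A * t\<^sup>2 < 1\<close> AB by (simp add: y_def)
      have "B\<^sup>2 * y\<^sup>2 - A\<^sup>2 * t\<^sup>2 = B - A * (A + B) * t\<^sup>2" using y by algebra
      then have "(B\<^sup>2 * y\<^sup>2 - A\<^sup>2 * t\<^sup>2) * g < 0" using t False g by (simp add: mult_pos_neg)
      from exists_state_at [OF AB y this] obtain u w where "(t, y, u, w) \<in> states A B g" by blast
      then show "t \<in> (\<lambda>(x, y, u, w). x) ` states A B g" by (rule rev_image_eqI) simp
    qed
    moreover have "0 < r" using AB by (simp add: r_def)
    ultimately show False
      using c uncountable_open_interval [of 0 r] by (meson countable_image countable_subset)
  qed
qed

lemma step_states:
  assumes AB: "A > 0" "B > 0" and "(x, y, u, w) \<in> states A B g" and st: "step A B (x, y, u, w) = (x', y', u', w')"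
    and ex: "(x', y', u', w') \<notin> exits A B g"
  shows "(x', y', u', w') \<in> states A B g" "B\<^sup>2 * y'\<^sup>2 - A\<^sup>2 * x'\<^sup>2 \<noteq> 0" "A * u\<^sup>2 + B * w\<^sup>2 \<noteq> 0"
proof -
  define m where "m = 2 / (A * u\<^sup>2 + B * w\<^sup>2)"
  define \<kappa> where "\<kappa> = B\<^sup>2 * y'\<^sup>2 - A\<^sup>2 * x'\<^sup>2"
  have e: "A * x\<^sup>2 + B * y\<^sup>2 = 1" "A * x * u + B * y * w = - 1" "A * B * (u\<^sup>2 - w\<^sup>2) = - g"
    using assms(3) unfolding states_def by auto
  have "u \<noteq> 0 \<or> w \<noteq> 0" using e(2) by auto
  then show b: "A * u\<^sup>2 + B * w\<^sup>2 \<noteq> 0"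
    using AB by (auto simp: add_nonneg_eq_0_iff)
  then have m: "m * (A * u\<^sup>2 + B * w\<^sup>2) = 2" unfolding m_def by (metis nonzero_eq_divide_eq)
  have s: "x' = x + m * u" "y' = y + m * w" "u' = u + 2 / \<kappa> * A * x'" "w' = w - 2 / \<kappa> * B * y'"
    using st unfolding step_def m_def \<kappa>_def by (auto simp: Let_def)
  have e': "A * x'\<^sup>2 + B * y'\<^sup>2 = 1" "A * x' * u + B * y' * w = 1"
    using e m unfolding s(1,2) by algebra+
  \<comment> \<open>With \<open>\<kappa> = 0\<close> the quotient \<open>2 / \<kappa>\<close> is 0,
    the velocity stays outward, and the new state would be an exit.\<close>
  have kap: "\<kappa> \<noteq> 0"
  proof
    assume "\<kappa> = 0"
    then have "u' = u" "w' = w" "B\<^sup>2 * y'\<^sup>2 - A\<^sup>2 * x'\<^sup>2 = 0" using s(3,4) by (simp_all add: \<kappa>_def)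
    then show False using ex e' e(3) unfolding exits_def by auto
  qed
  then show "B\<^sup>2 * y'\<^sup>2 - A\<^sup>2 * x'\<^sup>2 \<noteq> 0" unfolding \<kappa>_def .
  define n where "n = 2 / \<kappa>"
  have n: "n * (B\<^sup>2 * y'\<^sup>2 - A\<^sup>2 * x'\<^sup>2) = 2"
    using kap unfolding n_def \<kappa>_def by (metis nonzero_eq_divide_eq)
  have "A * x' * u' + B * y' * w' = - 1" "A * B * (u'\<^sup>2 - w'\<^sup>2) = - g"
    unfolding s(3,4) n_def [symmetric] using e' e(3) n by algebra+
  then show "(x', y', u', w') \<in> states A B g" using e' unfolding states_def by auto
qed

text \<open>Iterates of an injective map pull the finite set of exits back to finite sets. Their
  countable union cannot cover the uncountable set of states, so some state never reaches an
  exit.\<close>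

lemma exists_normalized_orbit:
  assumes AB: "A > 0" "B > 0" and g: "g \<noteq> 0" "g \<noteq> A" "g \<noteq> - B"
  shows "\<exists>x y u w mu nu. normalized_orbit A B g x y u w mu nu"
proof -
  have fin: "finite ((step A B ^^ Suc k) -` exits A B g)" for k
    using finite_exits [OF AB] inj_fn [OF inj_step] by (rule finite_vimageI)
  have "countable (\<Union>k. (step A B ^^ Suc k) -` exits A B g)"
    using countable_finite [OF fin] by (intro countable_UN countableI_type)
  then have "\<not> states A B g \<subseteq> (\<Union>k. (step A B ^^ Suc k) -` exits A B g)"
    using uncountable_states [OF AB g(1)] countable_subset by blast
  then obtain \<sigma>0 where \<sigma>0: "\<sigma>0 \<in> states A B g" and "\<And>k. (step A B ^^ Suc k) \<sigma>0 \<notin> exits A B g"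
    by blast
  then have ne: "step A B ((step A B ^^ k) \<sigma>0) \<notin> exits A B g" for k by simp
  define \<sigma> where "\<sigma> k = (step A B ^^ k) \<sigma>0" for k
  define x where "x k = fst (\<sigma> k)" for k
  define y where "y k = fst (snd (\<sigma> k))" for k
  define u where "u k = fst (snd (snd (\<sigma> k)))" for k
  define w where "w k = snd (snd (snd (\<sigma> k)))" for k
  have \<sigma>: "\<sigma> k = (x k, y k, u k, w k)" for k by (simp add: x_def y_def u_def w_def)
  have st: "step A B (x k, y k, u k, w k) = (x (Suc k), y (Suc k), u (Suc k), w (Suc k))" for k
    unfolding \<sigma> [symmetric] by (simp add: \<sigma>_def)
  have nex: "(x (Suc k), y (Suc k), u (Suc k), w (Suc k)) \<notin> exits A B g" for k
    using ne [of k] unfolding \<sigma> [symmetric] by (simp add: \<sigma>_def)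
  have S: "(x k, y k, u k, w k) \<in> states A B g" for k
  proof (induction k)
    case 0
    then show ?case using \<sigma>0 unfolding \<sigma> [symmetric] by (simp add: \<sigma>_def)
  next
    case (Suc k)
    then show ?case using step_states(1) [OF AB _ st nex] by blast
  qed
  have "normalized_orbit A B g x y u w (\<lambda>k. 2 / (A * (u k)\<^sup>2 + B * (w k)\<^sup>2))
      (\<lambda>k. 2 / (B\<^sup>2 * (y (Suc k))\<^sup>2 - A\<^sup>2 * (x (Suc k))\<^sup>2))"
  proof
    fix k
    show "A * (x k)\<^sup>2 + B * (y k)\<^sup>2 = 1" "A * x k * u k + B * y k * w k = - 1"
      "A * B * ((u k)\<^sup>2 - (w k)\<^sup>2) = - g"
      using S [of k] by (auto simp: states_def)
    show "2 / (A * (u k)\<^sup>2 + B * (w k)\<^sup>2) * (A * (u k)\<^sup>2 + B * (w k)\<^sup>2) = 2"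
      using step_states(3) [OF AB S st nex] by (metis nonzero_eq_divide_eq)
    show "2 / (B\<^sup>2 * (y (Suc k))\<^sup>2 - A\<^sup>2 * (x (Suc k))\<^sup>2) * (B\<^sup>2 * (y (Suc k))\<^sup>2 - A\<^sup>2 * (x (Suc k))\<^sup>2) = 2"
      using step_states(2) [OF AB S st nex] by (metis nonzero_eq_divide_eq)
    show "x (Suc k) = x k + 2 / (A * (u k)\<^sup>2 + B * (w k)\<^sup>2) * u k"
      "y (Suc k) = y k + 2 / (A * (u k)\<^sup>2 + B * (w k)\<^sup>2) * w k"
      "u (Suc k) = u k + 2 / (B\<^sup>2 * (y (Suc k))\<^sup>2 - A\<^sup>2 * (x (Suc k))\<^sup>2) * A * x (Suc k)"
      "w (Suc k) = w k - 2 / (B\<^sup>2 * (y (Suc k))\<^sup>2 - A\<^sup>2 * (x (Suc k))\<^sup>2) * B * y (Suc k)"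
      using st [of k] by (auto simp: step_def Let_def)
  qed (use AB g in auto)
  then show ?thesis by blast
qed

section \<open>Periodicity of all trajectories and the Pell equation\<close>

context ellipse_caustic
begin

lemma all_periodic_iff:
  assumes n: "n > 0"
  shows "(\<forall>X. billiard_trajectory a b X \<and> has_caustic a b \<gamma> X \<longrightarrow> n_periodic n X) \<longleftrightarrow>
    pell_solvable (1 / a) (1 / b) (1 / \<gamma>) n"
proof
  assume per: "\<forall>X. billiard_trajectory a b X \<and> has_caustic a b \<gamma> X \<longrightarrow> n_periodic n X"
  \<comment> \<open>The universally quantified hypothesis carries information only through an actual
    trajectory.\<close>
  obtain x y u w mu nu where orbit: "normalized_orbit (1 / a) (1 / b) (1 / \<gamma>) x y u w mu nu"
    using exists_normalized_orbit [of "1 / a" "1 / b" "1 / \<gamma>"] reciprocal_param a_pos b_pos by auto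
  then interpret normalized_orbit "1 / a" "1 / b" "1 / \<gamma>" x y u w mu nu .
  have "n_periodic n (\<lambda>k. (x k, y k))"
    using per orbit_imp_trajectory [OF orbit] by blast
  then have xy: "x (i + n) = x i" "y (i + n) = y i" for i
    by (auto simp: n_periodic_def)
  have 0: "x n = x 0" "y n = y 0" "x (Suc n) = x (Suc 0)" "y (Suc n) = y (Suc 0)"
    using xy [of 0] xy [of 1] by simp_all
  \<comment> \<open>Periodic vertices give equal displacements; pairing them with the gradient of
    the ellipse at the common vertex separates \<open>mu\<close> from the velocity through
    \<open>inward\<close>.\<close>
  have muw: "mu n * u n = mu 0 * u 0" "mu n * w n = mu 0 * w 0"
    using 0 x_Suc [of n] x_Suc [of 0] y_Suc [of n] y_Suc [of 0] by simp_all
  have "mu n * (1 / a * x n * u n + 1 / b * y n * w n) = 1 / a * x n * (mu n * u n) + 1 / b * y n * (mu n * w n)"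
    by (simp add: algebra_simps)
  also have "\<dots> = mu 0 * (1 / a * x 0 * u 0 + 1 / b * y 0 * w 0)"
    unfolding muw 0 by (simp add: algebra_simps)
  finally have "mu n = mu 0" unfolding inward by simp
  then have "u n = u 0" "w n = w 0" using muw mu_nonzero [of 0] by simp_all
  then show "pell_solvable (1 / a) (1 / b) (1 / \<gamma>) n"
    using periodic_imp_pell_solvable [OF n] 0 by blast
next
  assume ps: "pell_solvable (1 / a) (1 / b) (1 / \<gamma>) n"
  show "\<forall>X. billiard_trajectory a b X \<and> has_caustic a b \<gamma> X \<longrightarrow> n_periodic n X"
    unfolding n_periodic_def
  proof (intro allI impI)
    fix X i
    assume "billiard_trajectory a b X \<and> has_caustic a b \<gamma> X"
    \<comment> \<open>A shifted trajectory is again a trajectory, so closing at index 0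
      suffices.\<close>
    then have "billiard_trajectory a b (\<lambda>k. X (i + k))" "has_caustic a b \<gamma> (\<lambda>k. X (i + k))"
      by (simp_all add: billiard_trajectory_def has_caustic_def add.assoc [symmetric])
    then obtain u w mu nu where "normalized_orbit (1 / a) (1 / b) (1 / \<gamma>)
        (\<lambda>k. fst (X (i + k))) (\<lambda>k. snd (X (i + k))) u w mu nu"
      using trajectory_imp_orbit by blast
    from normalized_orbit.pell_solvable_imp_periodic [OF this ps] show "X (i + n) = X i"
      by (simp add: prod_eq_iff)
  qed
qed

end

theorem theorem7p1:
  fixes a b \<gamma> :: real and n :: nat
  assumes "a > 0" and "b > 0"
    and "\<gamma> \<notin> {-b, 0, a}"
    and "n \<ge> 3"
  shows "(\<forall>X. billiard_trajectory a b X \<and> has_caustic a b \<gamma> X \<longrightarrow> n_periodic n X) \<longleftrightarrow>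
    (\<exists>p q :: real poly.
       (\<forall>m. n = 2 * m \<longrightarrow>
          degree p = m \<and> degree q = m - 2 \<and>
          (\<forall>s. (poly p s)\<^sup>2 - s * (s - 1 / a) * (s + 1 / b) * (s - 1 / \<gamma>) * (poly q s)\<^sup>2 = 1)) \<and>
       (\<forall>m. n = 2 * m + 1 \<longrightarrow>
          degree p = m \<and> degree q = m - 1 \<and>
          (\<forall>s. (s - 1 / \<gamma>) * (poly p s)\<^sup>2 - s * (s - 1 / a) * (s + 1 / b) * (poly q s)\<^sup>2
                 = - sgn \<gamma>)))"
proof -
  interpret ellipse_caustic a b \<gamma>
    by unfold_locales (use assms in auto)
  show ?thesis
    using all_periodic_iff [of n] pell_solvable_iff [OF assms] assms(4) by simp
qed

end
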